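(* Let $(A,\mathfrak a)$ be a good pair over $\Bbbk$ and let $n\ge1$, $d\ge0$. The algebra $T^A_{\mathfrak a}(n,d)$ depends only on the subalgebra $\mathfrak a$, and not on the choice of the $(A,\mathfrak a)$-basis $B$: if $B$ and $B'$ are two $(A,\mathfrak a)$-bases (possibly with different complements of $\mathfrak a$ in $A_{\bar0}$), then the submodules of $S^A(n,d)$ defined as $T^A_{\mathfrak a}(n,d)$ using $B$ and using $B'$ coincide.
   Context: $\Bbbk$ is a commutative domain of characteristic $0$. Superalgebras are $\mathbb Z/2$-graded associative (not necessarily unital) $\Bbbk$-algebras $A=A_{\bar 0}\oplus A_{\bar 1}$; $\bar a$ denotes the parity of a homogeneous element $a$; tensor products of superalgebras carry the product $(x\otimes y)(z\otimes w)=(-1)^{\bar y\bar z}xz\otimes yw$. A good pair $(A,\mathfrak a)$ consists of a superalgebra $A$ with $A_{\bar 0},A_{\bar 1}$ free over $\Bbbk$ and a subalgebra $\mathfrak a\subseteq A_{\bar 0}$ such that $\mathfrak a$ and $A/\mathfrak a$ are free $\Bbbk$-modules. An $(A,\mathfrak a)$-basis is a $\Bbbk$-basis $B=B_{\mathfrak a}\sqcup B_{\mathfrak c}\sqcup B_{\bar 1}$ of $A$, where $B_{\mathfrak a}$, $B_{\mathfrak c}$, $B_{\bar 1}$ are bases of $\mathfrak a$, of some $\Bbbk$-module complement $\mathfrak c$ of $\mathfrak a$ in $A_{\bar 0}$, and of $A_{\bar 1}$, respectively. For $a\in A$ put $\xi^a_{r,s}:=aE_{r,s}\in M_n(A)$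 ($E_{r,s}$ the matrix units; $M_n(A)$ is a superalgebra via parities of entries). Write $[1,n]=\{1,\dots,n\}$. The symmetric group $\mathfrak S_d$ acts on the right on words by $(x_1\cdots x_d)\sigma=x_{\sigma 1}\cdots x_{\sigma d}$, diagonally on tuples of words, and on $M_n(A)^{\otimes d}$ by superalgebra automorphisms $(\xi^{a_1}_{r_1,s_1}\otimes\cdots\otimes\xi^{a_d}_{r_d,s_d})^\sigma=(-1)^{\langle\sigma;\boldsymbol a\rangle}\xi^{a_{\sigma1}}_{r_{\sigma1},s_{\sigma1}}\otimes\cdots\otimes\xi^{a_{\sigma d}}_{r_{\sigma d},s_{\sigma d}}$ for homogeneous $a_i$, where $\langle\sigma;\boldsymbol a\rangle=\#\{(k,l): k<l,\ \sigma^{-1}k>\sigma^{-1}l,\ a_k,a_l \text{ odd}\}$. Define $S^A(n,d):=(M_n(A)^{\otimes d})^{\mathfrak S_d}$. Given an $(A,\mathfrak a)$-basis $B$, $\mathrm{Tri}^B(n,d)$ is the set of triples $(\boldsymbol b,\boldsymbol r,\boldsymbol s)\in B^d\times[1,n]^d\times[1,n]^d$ such that for $k\ne l$ the equality $(b_k,r_k,s_k)=(b_l,r_l,s_l)$ holds only if $b_k$ is even. For such a triple let $\xi^{\boldsymbol b}_{\boldsymbol r,\boldsymbol s}:=\sum_\sigma(\xi^{b_1}_{r_1,s_1}\otimes\cdots\otimes\xi^{b_d}_{r_d,s_d})^\sigma\in S^A(n,d)$, with $\sigma$ over representatives of the cosets $\mathfrak S_{\boldsymbol b,\boldsymbol r,\boldsymbol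 s}\backslash\mathfrak S_d$, where $\mathfrak S_{\boldsymbol b,\boldsymbol r,\boldsymbol s}$ is the stabilizer of the triple. Let $[\boldsymbol b,\boldsymbol r,\boldsymbol s]^b_{r,s}:=\#\{k: (b_k,r_k,s_k)=(b,r,s)\}$, $[\boldsymbol b,\boldsymbol r,\boldsymbol s]^!_{\mathfrak c}:=\prod_{b\in B_{\mathfrak c},\,r,s\in[1,n]}[\boldsymbol b,\boldsymbol r,\boldsymbol s]^b_{r,s}!$, and $\eta^{\boldsymbol b}_{\boldsymbol r,\boldsymbol s}:=[\boldsymbol b,\boldsymbol r,\boldsymbol s]^!_{\mathfrak c}\,\xi^{\boldsymbol b}_{\boldsymbol r,\boldsymbol s}$. $T^A_{\mathfrak a}(n,d)$ (defined using $B$) is the $\Bbbk$-span of all $\eta^{\boldsymbol b}_{\boldsymbol r,\boldsymbol s}$ with $(\boldsymbol b,\boldsymbol r,\boldsymbol s)\in\mathrm{Tri}^B(n,d)$. *)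

theory Defs
  imports
    "HOL-Analysis.Finite_Cartesian_Product"
    "HOL-Library.Poly_Mapping"
    "HOL-Library.FuncSet"
    "HOL-Algebra.Sym_Groups"
begin

section \<open>Free modules on a set of words\<close>

definition fscale :: "'k::comm_ring_1 \<Rightarrow> ('w \<Rightarrow>\<^sub>0 'k) \<Rightarrow> ('w \<Rightarrow>\<^sub>0 'k)" where
  "fscale c v = Poly_Mapping.map ((*) c) v"

lemma lookup_fscale [simp]:
  "Poly_Mapping.lookup (fscale c v) x = c * Poly_Mapping.lookup v x"
  by (simp add: fscale_def Poly_Mapping.map.rep_eq when_def)

lemma module_fscale: "module (fscale :: 'k::comm_ring_1 \<Rightarrow> ('w \<Rightarrow>\<^sub>0 'k) \<Rightarrow> _)"
  by standard (auto intro!: poly_mapping_eqI simp: lookup_add algebra_simps)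

definition pure :: "'w \<Rightarrow> ('w \<Rightarrow>\<^sub>0 'k::comm_ring_1)" where
  "pure x = Poly_Mapping.single x 1"

text \<open>Words of length \<open>d\<close> are functions on \<open>{1..d}\<close>; outside \<open>{1..d}\<close> they are
  \<open>undefined\<close>, so that equality of functions is equality of words, and
  \<open>x \<circ> \<sigma>\<close> is the word \<open>x\<^sub>\<sigma>\<^sub>1 \<dots> x\<^sub>\<sigma>\<^sub>d\<close> for every permutation \<open>\<sigma>\<close> of \<open>{1..d}\<close>.\<close>

definition words :: "nat \<Rightarrow> 'x set \<Rightarrow> (nat \<Rightarrow> 'x) set" where
  "words d X = {1..d} \<rightarrow>\<^sub>E X"


section \<open>Superalgebras\<close>

locale superalgebra = module scale
  for scale :: "'k::{idom,ring_char_0} \<Rightarrow> 'a::ring \<Rightarrow> 'a" (infixr \<open>\<cdot>\<close> 75) +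
  fixes A0 A1 :: "'a set"
  assumes scale_mult_left: "(c \<cdot> x) * y = c \<cdot> (x * y)"
    and scale_mult_right: "x * (c \<cdot> y) = c \<cdot> (x * y)"
    and subspace_A0: "subspace A0"
    and subspace_A1: "subspace A1"
    and A0_Int_A1: "A0 \<inter> A1 = {0}"
    and A0_plus_A1: "\<exists>x\<in>A0. \<exists>y\<in>A1. z = x + y"
    and mult_00: "x \<in> A0 \<Longrightarrow> y \<in> A0 \<Longrightarrow> x * y \<in> A0"
    and mult_01: "x \<in> A0 \<Longrightarrow> y \<in> A1 \<Longrightarrow> x * y \<in> A1"
    and mult_10: "x \<in> A1 \<Longrightarrow> y \<in> A0 \<Longrightarrow> x * y \<in> A1"
    and mult_11: "x \<in> A1 \<Longrightarrow> y \<in> A1 \<Longrightarrow> x * y \<in> A0"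
begin

definition subalgebra :: "'a set \<Rightarrow> bool" where
  "subalgebra U \<longleftrightarrow> subspace U \<and> (\<forall>x\<in>U. \<forall>y\<in>U. x * y \<in> U)"

definition basis_of :: "'a set \<Rightarrow> 'a set \<Rightarrow> bool" where
  "basis_of X V \<longleftrightarrow> independent X \<and> span X = V"

definition free_submodule :: "'a set \<Rightarrow> bool" where
  "free_submodule V \<longleftrightarrow> (\<exists>X. basis_of X V)"

text \<open>\<open>A / U\<close> is free: it has a basis, given here by a set \<open>X\<close> of representatives in \<open>A\<close>.
  The second condition also makes the elements of \<open>X\<close> pairwise distinct modulo \<open>U\<close>.\<close>

definition free_quotient :: "'a set \<Rightarrow> bool" where
  "free_quotient U \<longleftrightarrow> (\<exists>X.
     (\<forall>a. \<exists>x\<in>span X. a - x \<in> U) \<and>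
     (\<forall>t u. finite t \<and> t \<subseteq> X \<and> (\<Sum>x\<in>t. u x \<cdot> x) \<in> U \<longrightarrow> (\<forall>x\<in>t. u x = 0)))"

definition complement_in :: "'a set \<Rightarrow> 'a set \<Rightarrow> 'a set \<Rightarrow> bool" where
  "complement_in V U W \<longleftrightarrow>
     subspace W \<and> U \<inter> W = {0} \<and> {x + y |x y. x \<in> U \<and> y \<in> W} = V"

text \<open>\<open>part False\<close> and \<open>part True\<close> are the projections to the even and to the odd part.\<close>

definition part :: "bool \<Rightarrow> 'a \<Rightarrow> 'a" where
  "part q a =
     (let e = (THE x. x \<in> A0 \<and> a - x \<in> A1) in if q then a - e else e)"


section \<open>The tensor power of the matrix superalgebra\<close>

definition mpart :: "bool \<Rightarrow> 'a^'n^'n \<Rightarrow> 'a^'n^'n" where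
  "mpart q X = (\<chi> i j. part q (X $ i $ j))"

definition mscale :: "'k \<Rightarrow> 'a^'n^'n \<Rightarrow> 'a^'n^'n" where
  "mscale c X = (\<chi> i j. c \<cdot> (X $ i $ j))"

text \<open>\<open>munit a r s\<close> is \<open>\<xi>\<^sup>a\<^sub>r\<^sub>,\<^sub>s = a E\<^sub>r\<^sub>,\<^sub>s\<close>.\<close>

definition munit :: "'a \<Rightarrow> 'n \<Rightarrow> 'n \<Rightarrow> 'a^'n^'n" where
  "munit a r s = (\<chi> i j. if i = r \<and> j = s then a else 0)"

text \<open>The \<open>d\<close>-th tensor power of \<open>M\<^sub>n(A)\<close> is the free module on words of length \<open>d\<close> in
  \<open>M\<^sub>n(A)\<close> modulo the relations of multilinearity. Its elements are cosets \<open>tclass d v\<close>, and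
  \<open>tclass d (pure x)\<close> is \<open>x\<^sub>1 \<otimes> \<dots> \<otimes> x\<^sub>d\<close>.\<close>

definition tensor_relations :: "nat \<Rightarrow> ((nat \<Rightarrow> 'a^'n^'n) \<Rightarrow>\<^sub>0 'k) set" where
  "tensor_relations d =
     {pure (x(i := X + Y)) - pure (x(i := X)) - pure (x(i := Y)) |x i X Y.
        x \<in> words d UNIV \<and> i \<in> {1..d}} \<union>
     {pure (x(i := mscale c X)) - fscale c (pure (x(i := X))) |x i c X.
        x \<in> words d UNIV \<and> i \<in> {1..d}}"

definition tensor_null :: "nat \<Rightarrow> ((nat \<Rightarrow> 'a^'n^'n) \<Rightarrow>\<^sub>0 'k) set" where
  "tensor_null d = module.span fscale (tensor_relations d)"

definition tclass ::
  "nat \<Rightarrow> ((nat \<Rightarrow> 'a^'n^'n) \<Rightarrow>\<^sub>0 'k) \<Rightarrow> ((nat \<Rightarrow> 'a^'n^'n) \<Rightarrow>\<^sub>0 'k) set" where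
  "tclass d v = {w. w - v \<in> tensor_null d}"

definition tensor_power :: "nat \<Rightarrow> ((nat \<Rightarrow> 'a^'n^'n) \<Rightarrow>\<^sub>0 'k) set set" where
  "tensor_power d = tclass d ` {v. Poly_Mapping.keys v \<subseteq> words d UNIV}"

text \<open>\<open>inversions d \<sigma> \<epsilon>\<close> is \<open>\<langle>\<sigma>; \<^bold>a\<rangle>\<close> for homogeneous \<open>a\<^sub>1, \<dots>, a\<^sub>d\<close>, where \<open>\<epsilon> k\<close> means that
  \<open>a\<^sub>k\<close> is odd.\<close>

definition inversions :: "nat \<Rightarrow> (nat \<Rightarrow> nat) \<Rightarrow> (nat \<Rightarrow> bool) \<Rightarrow> nat" where
  "inversions d \<sigma> \<epsilon> =
     card {(k, l). k \<in> {1..d} \<and> l \<in> {1..d} \<and> k < l \<and>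
       inv_into UNIV \<sigma> k > inv_into UNIV \<sigma> l \<and> \<epsilon> k \<and> \<epsilon> l}"

text \<open>The right action of a permutation \<open>\<sigma>\<close> is given on tensors of homogeneous matrices by a
  signed permutation of the factors (see \<open>act_homogeneous\<close> below). The linear map \<open>act d \<sigma>\<close> lifts
  it to the free module, by decomposing each factor of a word into its even and odd parts.\<close>

definition act ::
  "nat \<Rightarrow> (nat \<Rightarrow> nat) \<Rightarrow> ((nat \<Rightarrow> 'a^'n^'n) \<Rightarrow>\<^sub>0 'k) \<Rightarrow> ((nat \<Rightarrow> 'a^'n^'n) \<Rightarrow>\<^sub>0 'k)" where
  "act d \<sigma> v =
     (\<Sum>x\<in>Poly_Mapping.keys v. \<Sum>\<epsilon>\<in>words d UNIV.
        fscale (Poly_Mapping.lookup v x * (-1) ^ inversions d \<sigma> \<epsilon>)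
          (pure (\<lambda>i\<in>{1..d}. mpart (\<epsilon> (\<sigma> i)) (x (\<sigma> i)))))"

definition tact ::
  "nat \<Rightarrow> (nat \<Rightarrow> nat) \<Rightarrow> ((nat \<Rightarrow> 'a^'n^'n) \<Rightarrow>\<^sub>0 'k) set \<Rightarrow> ((nat \<Rightarrow> 'a^'n^'n) \<Rightarrow>\<^sub>0 'k) set"
  where "tact d \<sigma> X = (\<Union>v\<in>X. tclass d (act d \<sigma> v))"

text \<open>\<open>schur_S d\<close> is \<open>S\<^sup>A(n, d)\<close>, with \<open>n = CARD('n)\<close>.\<close>

definition schur_S :: "nat \<Rightarrow> ((nat \<Rightarrow> 'a^'n^'n) \<Rightarrow>\<^sub>0 'k) set set" where
  "schur_S d =
     {X \<in> tensor_power d. \<forall>\<sigma>\<in>carrier (sym_group d). tact d \<sigma> X = X}"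


section \<open>The submodule spanned by the elements \<open>\<eta>\<close>\<close>

text \<open>A basis \<open>B = B\<^sub>\<aa> \<squnion> B\<^sub>\<cc> \<squnion> B\<^sub>1\<close> is given by its three parts \<open>Ba\<close>, \<open>Bc\<close>, \<open>B1\<close>.\<close>

definition Tri :: "nat \<Rightarrow> 'a set \<Rightarrow> ((nat \<Rightarrow> 'a) \<times> (nat \<Rightarrow> 'n) \<times> (nat \<Rightarrow> 'n)) set" where
  "Tri d B =
     {(b, r, s). b \<in> words d B \<and> r \<in> words d UNIV \<and> s \<in> words d UNIV \<and>
        (\<forall>k\<in>{1..d}. \<forall>l\<in>{1..d}. k \<noteq> l \<and> (b k, r k, s k) = (b l, r l, s l) \<longrightarrow> b k \<in> A0)}"

definition stab :: "nat \<Rightarrow> (nat \<Rightarrow> 'a) \<Rightarrow> (nat \<Rightarrow> 'n) \<Rightarrow> (nat \<Rightarrow> 'n) \<Rightarrow> (nat \<Rightarrow> nat) set" where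
  "stab d b r s =
     {\<sigma> \<in> carrier (sym_group d). b \<circ> \<sigma> = b \<and> r \<circ> \<sigma> = r \<and> s \<circ> \<sigma> = s}"

text \<open>\<open>xi\<close> and \<open>eta\<close> are representatives in the free module of elements of the tensor power.
  The class of \<open>xi d b r s\<close> does not depend on the chosen coset representatives.\<close>

definition xi ::
  "nat \<Rightarrow> (nat \<Rightarrow> 'a) \<Rightarrow> (nat \<Rightarrow> 'n) \<Rightarrow> (nat \<Rightarrow> 'n) \<Rightarrow> ((nat \<Rightarrow> 'a^'n^'n) \<Rightarrow>\<^sub>0 'k)" where
  "xi d b r s =
     (\<Sum>C\<in>rcosets\<^bsub>sym_group d\<^esub> (stab d b r s).
        act d (SOME \<sigma>. \<sigma> \<in> C) (pure (\<lambda>k\<in>{1..d}. munit (b k) (r k) (s k))))"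

text \<open>The product runs only over the elements of \<open>Bc\<close> that occur in \<open>b\<close>: the others contribute
  \<open>0! = 1\<close>, while a product over an infinite \<open>Bc\<close> would by convention be \<open>1\<close>.\<close>

definition cfact :: "nat \<Rightarrow> 'a set \<Rightarrow> (nat \<Rightarrow> 'a) \<Rightarrow> (nat \<Rightarrow> 'n::finite) \<Rightarrow> (nat \<Rightarrow> 'n) \<Rightarrow> nat" where
  "cfact d Bc b r s =
     (\<Prod>c\<in>Bc \<inter> b ` {1..d}. \<Prod>i\<in>UNIV. \<Prod>j\<in>UNIV.
        fact (card {k \<in> {1..d}. b k = c \<and> r k = i \<and> s k = j}))"

definition eta ::
  "nat \<Rightarrow> 'a set \<Rightarrow> (nat \<Rightarrow> 'a) \<Rightarrow> (nat \<Rightarrow> 'n::finite) \<Rightarrow> (nat \<Rightarrow> 'n)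
    \<Rightarrow> ((nat \<Rightarrow> 'a^'n^'n) \<Rightarrow>\<^sub>0 'k)" where
  "eta d Bc b r s = fscale (of_nat (cfact d Bc b r s)) (xi d b r s)"

text \<open>The span of the classes of the \<open>\<eta>\<close>, as the image of the span in the free module.\<close>

definition schur_T ::
  "nat \<Rightarrow> 'a set \<Rightarrow> 'a set \<Rightarrow> 'a set \<Rightarrow> ((nat \<Rightarrow> 'a^'n::finite^'n) \<Rightarrow>\<^sub>0 'k) set set" where
  "schur_T d Ba Bc B1 =
     tclass d ` module.span fscale {eta d Bc b r s |b r s. (b, r, s) \<in> Tri d (Ba \<union> Bc \<union> B1)}"

end

locale good_pair = superalgebra scale A0 A1
  for scale :: "'k::{idom,ring_char_0} \<Rightarrow> 'a::ring \<Rightarrow> 'a" (infixr \<open>\<cdot>\<close> 75)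
    and A0 A1 :: "'a set" +
  fixes \<aa> :: "'a set"
  assumes free_A0: "free_submodule A0"
    and free_A1: "free_submodule A1"
    and subalgebra_a: "subalgebra \<aa>"
    and a_subset: "\<aa> \<subseteq> A0"
    and free_a: "free_submodule \<aa>"
    and free_quotient_a: "free_quotient \<aa>"
begin

definition adapted_basis :: "'a set \<Rightarrow> 'a set \<Rightarrow> 'a set \<Rightarrow> bool" where
  "adapted_basis Ba Bc B1 \<longleftrightarrow>
     Ba \<inter> Bc = {} \<and> Ba \<inter> B1 = {} \<and> Bc \<inter> B1 = {} \<and>
     basis_of (Ba \<union> Bc \<union> B1) UNIV \<and>
     basis_of Ba \<aa> \<and> (\<exists>\<cc>. complement_in A0 \<aa> \<cc> \<and> basis_of Bc \<cc>) \<and> basis_of B1 A1"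

end


section \<open>The action on tensors of homogeneous matrices\<close>

context superalgebra
begin

lemma part_unique:
  assumes "x \<in> A0" "y \<in> A1"
  shows "part False (x + y) = x" "part True (x + y) = y"
proof -
  have "(THE z. z \<in> A0 \<and> x + y - z \<in> A1) = x"
  proof (rule the_equality)
    show "x \<in> A0 \<and> x + y - x \<in> A1" using assms by simp
    fix z assume z: "z \<in> A0 \<and> x + y - z \<in> A1"
    have "x - z \<in> A0" using z assms subspace_A0 subspace_diff by blast
    moreover have "x - z = (x + y - z) - y" by simp
    then have "x - z \<in> A1" using z assms subspace_A1 subspace_diff by metis
    ultimately have "x - z = 0" using A0_Int_A1 by blast
    then show "z = x" by simp
  qed
  then show "part False (x + y) = x" "part True (x + y) = y"
    by (simp_all add: part_def)
qed

lemma part_homogeneous: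
  assumes "if p then a \<in> A1 else a \<in> A0"
  shows "part q a = (if q = p then a else 0)"
proof (cases p)
  case True
  then show ?thesis
    using part_unique[of 0 a] assms subspace_A0 subspace_0 by (cases q) auto
next
  case False
  then show ?thesis
    using part_unique[of a 0] assms subspace_A1 subspace_0 by (cases q) auto
qed

lemma mpart_homogeneous:
  assumes "\<And>i j. if p then X $ i $ j \<in> A1 else X $ i $ j \<in> A0"
  shows "mpart q X = (if q = p then X else 0)"
  using part_homogeneous[OF assms] by (auto simp: mpart_def vec_eq_iff)

lemma pure_zero_in_null:
  assumes x: "x \<in> words d UNIV" and i: "i \<in> {1..d}" "x i = 0"
  shows "pure x \<in> (tensor_null d :: ((nat \<Rightarrow> 'a^'n^'n) \<Rightarrow>\<^sub>0 'k) set)"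
proof -
  interpret F: module "fscale :: 'k \<Rightarrow> ((nat \<Rightarrow> 'a^'n^'n) \<Rightarrow>\<^sub>0 'k) \<Rightarrow> _" by (rule module_fscale)
  have "pure (x(i := 0 + 0)) - pure (x(i := 0)) - pure (x(i := 0))
      \<in> (tensor_relations d :: ((nat \<Rightarrow> 'a^'n^'n) \<Rightarrow>\<^sub>0 'k) set)"
    unfolding tensor_relations_def using x i(1) by blast
  then have "- pure x \<in> (tensor_null d :: ((nat \<Rightarrow> 'a^'n^'n) \<Rightarrow>\<^sub>0 'k) set)"
    unfolding tensor_null_def using i(2) fun_upd_triv[of x i] by (auto intro: F.span_base)
  then show ?thesis
    unfolding tensor_null_def using F.span_neg by fastforce
qed

lemma act_homogeneous:
  fixes x :: "nat \<Rightarrow> 'a^'n^'n"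
  assumes x: "x \<in> words d UNIV" and \<sigma>: "\<sigma> permutes {1..d}" and p: "p \<in> words d UNIV"
    and hom: "\<And>k i j. k \<in> {1..d} \<Longrightarrow> if p k then x k $ i $ j \<in> A1 else x k $ i $ j \<in> A0"
  shows "tclass d (act d \<sigma> (pure x)) = tclass d (fscale ((-1) ^ inversions d \<sigma> p) (pure (x \<circ> \<sigma>)))"
proof -
  interpret F: module "fscale :: 'k \<Rightarrow> ((nat \<Rightarrow> 'a^'n^'n) \<Rightarrow>\<^sub>0 'k) \<Rightarrow> _" by (rule module_fscale)
  let ?N = "tensor_null d :: ((nat \<Rightarrow> 'a^'n^'n) \<Rightarrow>\<^sub>0 'k) set"
  let ?t = "\<lambda>\<epsilon>. fscale ((-1) ^ inversions d \<sigma> \<epsilon>)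
      (pure (\<lambda>i\<in>{1..d}. mpart (\<epsilon> (\<sigma> i)) (x (\<sigma> i)))) :: (nat \<Rightarrow> 'a^'n^'n) \<Rightarrow>\<^sub>0 'k"
  have fin: "finite (words d (UNIV :: bool set))"
    by (simp add: words_def finite_PiE)
  have \<sigma>k: "\<sigma> k \<in> {1..d}" if "k \<in> {1..d}" for k
    using \<sigma> that permutes_in_image by metis
  have act: "act d \<sigma> (pure x) = (\<Sum>\<epsilon>\<in>words d UNIV. ?t \<epsilon>)"
    by (simp add: act_def pure_def)
  also have "\<dots> = ?t p + (\<Sum>\<epsilon>\<in>words d UNIV - {p}. ?t \<epsilon>)"
    using fin p by (simp add: sum.remove)
  finally have eq: "act d \<sigma> (pure x) = ?t p + (\<Sum>\<epsilon>\<in>words d UNIV - {p}. ?t \<epsilon>)" .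
  have "(\<lambda>i\<in>{1..d}. mpart (p (\<sigma> i)) (x (\<sigma> i))) = x \<circ> \<sigma>"
  proof
    fix i
    show "(\<lambda>i\<in>{1..d}. mpart (p (\<sigma> i)) (x (\<sigma> i))) i = (x \<circ> \<sigma>) i"
    proof (cases "i \<in> {1..d}")
      case True
      then show ?thesis using mpart_homogeneous[OF hom[OF \<sigma>k[OF True]]] by simp
    next
      case False
      then have "\<sigma> i = i" "x i = undefined"
        using permutes_not_in[OF \<sigma>] PiE_arb[OF x[unfolded words_def]] by auto
      then show ?thesis using False by auto
    qed
  qed
  then have tp: "?t p = fscale ((-1) ^ inversions d \<sigma> p) (pure (x \<circ> \<sigma>))" by simp
  have "?t \<epsilon> \<in> ?N" if \<epsilon>: "\<epsilon> \<in> words d UNIV - {p}" for \<epsilon>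
  proof -
    have "\<exists>k\<in>{1..d}. \<epsilon> k \<noteq> p k"
      using \<epsilon> p PiE_ext[of \<epsilon> "{1..d}" "\<lambda>_. UNIV" p] by (auto simp: words_def)
    then obtain k where k: "k \<in> {1..d}" "\<epsilon> k \<noteq> p k" by blast
    obtain i where i: "\<sigma> i = k" using permutes_surj[OF \<sigma>] by (metis surjD)
    have i': "i \<in> {1..d}" using i k \<sigma> permutes_in_image by metis
    have "mpart (\<epsilon> (\<sigma> i)) (x (\<sigma> i)) = 0"
      using mpart_homogeneous[OF hom[OF k(1)]] k i by simp
    then have "(pure (\<lambda>i\<in>{1..d}. mpart (\<epsilon> (\<sigma> i)) (x (\<sigma> i)))) \<in> ?N"
      using i' by (intro pure_zero_in_null[of _ d i]) (auto simp: words_def)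
    then show ?thesis unfolding tensor_null_def by (rule F.span_scale)
  qed
  then have "act d \<sigma> (pure x) - ?t p \<in> ?N"
    unfolding eq tensor_null_def by (auto intro: F.span_sum)
  moreover have "tclass d v = tclass d w" if "v - w \<in> ?N" for v w
  proof -
    have "u - v \<in> ?N \<longleftrightarrow> u - w \<in> ?N" for u
    proof
      assume "u - v \<in> ?N"
      then have "(u - v) + (v - w) \<in> ?N"
        using that unfolding tensor_null_def by (rule F.span_add)
      then show "u - w \<in> ?N" by simp
    next
      assume "u - w \<in> ?N"
      then have "(u - w) - (v - w) \<in> ?N"
        using that unfolding tensor_null_def by (rule F.span_diff)
      then show "u - v \<in> ?N" by simp
    qed
    then show ?thesis unfolding tclass_def by blast
  qed
  ultimately show ?thesis unfolding tp by blast
qed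

end

end

theory Submission
  imports Defs
begin

text \<open>
  Fix an adapted basis \<open>B\<close> and expand tensors in the words over \<open>B \<times> [1, n] \<times> [1, n]\<close>.
  The classes in \<open>T\<close> are exactly those of the symmetric tensors whose coordinate at each word \<open>w\<close> is
  divisible by \<open>[w]\<^sup>!\<close>, which is the order of the group of the permutations that fix \<open>w\<close> and move
  only positions with letters from \<open>Bc\<close>. Symmetry does not involve the basis, so
  only the divisibility has to be transferred to another basis \<open>B'\<close>. The coordinate at a
  \<open>B'\<close>-word \<open>u\<close> is a sum of terms indexed by the \<open>B\<close>-words \<open>w\<close>, and the group \<open>G\<close> of \<open>u\<close> permutes these
  terms. As \<open>\<aa>\<close> and \<open>A\<^sub>1\<close> have no \<open>Bc'\<close>-components, a term is nonzero only if \<open>w\<close> has letters from \<open>Bc\<close>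
  at all positions moved by \<open>G\<close>. Hence the stabilizer of \<open>w\<close> in \<open>G\<close> lies in the group
  of \<open>w\<close>, its order divides the term by Lagrange's theorem, and so \<open>card G\<close> divides the sum over the
  orbit.
\<close>

section \<open>Permutations and invariant sums\<close>

text \<open>Puts membership in a subgroup in terms of \<open>\<circ>\<close> and
  \<open>inv'\<close>, because words are permuted by plain composition of functions.\<close>

lemma sym_subgroupD:
  assumes "subgroup G (sym_group d)"
  shows "\<And>\<sigma>. \<sigma> \<in> G \<Longrightarrow> \<sigma> permutes {1..d}" "id \<in> G"
    "\<And>\<sigma> \<tau>. \<sigma> \<in> G \<Longrightarrow> \<tau> \<in> G \<Longrightarrow> \<sigma> \<circ> \<tau> \<in> G" "\<And>\<sigma>. \<sigma> \<in> G \<Longrightarrow> inv' \<sigma> \<in> G" "finite G"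
proof -
  interpret S: subgroup G "sym_group d" by fact
  show p: "\<sigma> permutes {1..d}" if "\<sigma> \<in> G" for \<sigma>
    using S.subset that by (auto simp: sym_group_def)
  show "id \<in> G" using S.one_closed by (simp add: sym_group_def)
  show "\<sigma> \<circ> \<tau> \<in> G" if "\<sigma> \<in> G" "\<tau> \<in> G" for \<sigma> \<tau>
    using S.m_closed[OF that] by (simp add: sym_group_def)
  show "inv' \<sigma> \<in> G" if "\<sigma> \<in> G" for \<sigma>
  proof -
    let ?j = "m_inv (sym_group d) \<sigma>"
    have j: "?j \<in> G" using that by (rule S.m_inv_closed)
    have "\<sigma> \<circ> ?j = id"
      using group.r_inv[OF sym_group_is_group, of \<sigma> d] p[OF that] by (simp add: sym_group_def)
    then have "inv' \<sigma> = inv' \<sigma> \<circ> (\<sigma> \<circ> ?j)" by simp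
    also have "\<dots> = ?j" by (simp only: o_assoc permutes_inv_o(2)[OF p[OF that]] id_comp)
    finally have "inv' \<sigma> = ?j" .
    with j show ?thesis by simp
  qed
  show "finite G"
    using p by (rule_tac finite_subset[OF _ finite_permutations[of "{1..d}"]]) auto
qed

lemma sym_subgroupI:
  assumes "\<And>\<sigma>. \<sigma> \<in> G \<Longrightarrow> \<sigma> permutes {1..d}" "id \<in> G"
    "\<And>\<sigma> \<tau>. \<sigma> \<in> G \<Longrightarrow> \<tau> \<in> G \<Longrightarrow> \<sigma> \<circ> \<tau> \<in> G" "\<And>\<sigma>. \<sigma> \<in> G \<Longrightarrow> inv' \<sigma> \<in> G"
  shows "subgroup G (sym_group d)"
proof (rule group.subgroupI[OF sym_group_is_group])
  show "G \<subseteq> carrier (sym_group d)" using assms(1) by (auto simp: sym_group_def)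
  show "G \<noteq> {}" using assms(2) by auto
  show "\<sigma> \<otimes>\<^bsub>sym_group d\<^esub> \<tau> \<in> G" if "\<sigma> \<in> G" "\<tau> \<in> G" for \<sigma> \<tau>
    using assms(3)[OF that] by (simp add: sym_group_def)
  show "m_inv (sym_group d) \<sigma> \<in> G" if \<sigma>: "\<sigma> \<in> G" for \<sigma>
  proof -
    have "m_inv (sym_group d) \<sigma> = inv' \<sigma>"
      by (rule group.inv_equality[OF sym_group_is_group])
        (use permutes_inv_o[OF assms(1)[OF \<sigma>]] permutes_inv[OF assms(1)[OF \<sigma>]] assms(1)[OF \<sigma>]
          in \<open>auto simp: sym_group_def\<close>)
    with assms(4)[OF \<sigma>] show ?thesis by simp
  qed
qed

lemma comp_inv_fixed:
  assumes "\<sigma> permutes S" "w \<circ> \<sigma> = w"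
  shows "w \<circ> inv' \<sigma> = w"
proof -
  have "w \<circ> inv' \<sigma> = w \<circ> (\<sigma> \<circ> inv' \<sigma>)" by (simp only: o_assoc assms(2))
  then show ?thesis by (simp only: permutes_inv_o(1)[OF assms(1)] comp_id)
qed

text \<open>Serves two groups: \<open>Q = {1..d}\<close> gives the full stabilizer of a triple, and
  the positions with letters from \<open>C\<close> give \<open>part_stabilizer\<close>.\<close>

lemma subgroup_stabilizer:
  assumes "Q \<subseteq> {1..d}"
  shows "subgroup {\<sigma>. \<sigma> permutes Q \<and> w \<circ> \<sigma> = w} (sym_group d)"
proof (rule sym_subgroupI)
  show "\<sigma> permutes {1..d}" if "\<sigma> \<in> {\<sigma>. \<sigma> permutes Q \<and> w \<circ> \<sigma> = w}" for \<sigma>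
    using that permutes_subset[OF _ assms] by blast
  show "\<sigma> \<circ> \<tau> \<in> {\<sigma>. \<sigma> permutes Q \<and> w \<circ> \<sigma> = w}"
    if "\<sigma> \<in> {\<sigma>. \<sigma> permutes Q \<and> w \<circ> \<sigma> = w}" "\<tau> \<in> {\<sigma>. \<sigma> permutes Q \<and> w \<circ> \<sigma> = w}" for \<sigma> \<tau>
    using that by (simp add: permutes_compose o_assoc)
  show "inv' \<sigma> \<in> {\<sigma>. \<sigma> permutes Q \<and> w \<circ> \<sigma> = w}"
    if "\<sigma> \<in> {\<sigma>. \<sigma> permutes Q \<and> w \<circ> \<sigma> = w}" for \<sigma>
    using that comp_inv_fixed[of \<sigma> Q w] by (simp add: permutes_inv)
qed (simp add: permutes_id)

text \<open>Lagrange's theorem, with \<open>H\<close> as the ambient group.\<close>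

lemma card_sym_subgroup_dvd:
  assumes "subgroup K (sym_group d)" "subgroup H (sym_group d)" "K \<subseteq> H"
  shows "card K dvd card H"
proof -
  interpret group "sym_group d" by (rule sym_group_is_group)
  have "subgroup K (sym_group d\<lparr>carrier := H\<rparr>)"
    using subgroup_incl assms by blast
  then have "card (rcosets\<^bsub>sym_group d\<lparr>carrier := H\<rparr>\<^esub> K) * card K = order (sym_group d\<lparr>carrier := H\<rparr>)"
    by (rule group.lagrange[OF subgroup_imp_group[OF assms(2)]])
  then have "card H = card (rcosets\<^bsub>sym_group d\<lparr>carrier := H\<rparr>\<^esub> K) * card K"
    by (simp add: order_def)
  then show ?thesis by (rule dvdI[OF trans[OF _ mult.commute]])
qed

text \<open>The map \<open>(\<circ>) w\<close> from \<open>G\<close> onto the orbit has fibres of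
  equal size: composing with \<rho> on the right takes the stabilizer to the fibre over
  \<open>w \<circ> \<rho>\<close>.\<close>

lemma card_orbit_stabilizer:
  assumes G: "subgroup G (sym_group d)"
  shows "card ((\<circ>) w ` G) * card {\<sigma> \<in> G. w \<circ> \<sigma> = w} = card G"
proof -
  note g = sym_subgroupD[OF G]
  have "card G = (\<Sum>u\<in>(\<circ>) w ` G. card {\<sigma> \<in> G. w \<circ> \<sigma> = u})"
    using sum.image_gen[OF g(5), of "\<lambda>_. 1::nat" "(\<circ>) w"] by simp
  also have "\<dots> = (\<Sum>u\<in>(\<circ>) w ` G. card {\<sigma> \<in> G. w \<circ> \<sigma> = w})"
  proof (rule sum.cong[OF refl])
    fix u assume "u \<in> (\<circ>) w ` G"
    then obtain \<rho> where \<rho>: "\<rho> \<in> G" "u = w \<circ> \<rho>" by auto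
    note i = permutes_inv_o[OF g(1)[OF \<rho>(1)]]
    have "bij_betw (\<lambda>\<tau>. \<tau> \<circ> \<rho>) {\<sigma> \<in> G. w \<circ> \<sigma> = w} {\<sigma> \<in> G. w \<circ> \<sigma> = u}"
    proof (rule bij_betwI[where g = "\<lambda>\<tau>. \<tau> \<circ> inv' \<rho>"])
      show "(\<lambda>\<tau>. \<tau> \<circ> \<rho>) \<in> {\<sigma> \<in> G. w \<circ> \<sigma> = w} \<rightarrow> {\<sigma> \<in> G. w \<circ> \<sigma> = u}"
        using \<rho> g(3) by (auto simp only: Pi_iff mem_Collect_eq o_assoc)
      show "(\<lambda>\<tau>. \<tau> \<circ> inv' \<rho>) \<in> {\<sigma> \<in> G. w \<circ> \<sigma> = u} \<rightarrow> {\<sigma> \<in> G. w \<circ> \<sigma> = w}"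
      proof
        fix \<sigma> assume "\<sigma> \<in> {\<sigma> \<in> G. w \<circ> \<sigma> = u}"
        then have "\<sigma> \<in> G" "w \<circ> \<sigma> = w \<circ> \<rho>" using \<rho>(2) by auto
        then have "w \<circ> (\<sigma> \<circ> inv' \<rho>) = w \<circ> (\<rho> \<circ> inv' \<rho>)" "\<sigma> \<circ> inv' \<rho> \<in> G"
          using g(3)[OF _ g(4)[OF \<rho>(1)]] by (simp_all only: o_assoc)
        then show "\<sigma> \<circ> inv' \<rho> \<in> {\<sigma> \<in> G. w \<circ> \<sigma> = w}" by (simp only: i comp_id mem_Collect_eq)
      qed
    qed (simp_all only: comp_assoc i comp_id)
    then show "card {\<sigma> \<in> G. w \<circ> \<sigma> = u} = card {\<sigma> \<in> G. w \<circ> \<sigma> = w}"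
      by (rule bij_betw_same_card[symmetric])
  qed
  finally show ?thesis by simp
qed

text \<open>\<open>W\<close> is a union of orbits. The orbit of \<open>w\<close> contributes its
  length times \<open>f w\<close>. The order of the stabilizer divides \<open>f w\<close>, and its
  product with the length is \<open>card G\<close>. The induction removes one orbit at a
  time.\<close>

lemma card_dvd_sum_invariant:
  fixes f :: "(nat \<Rightarrow> 'i) \<Rightarrow> 'k::comm_ring_1"
  assumes G: "subgroup G (sym_group d)" and "finite W"
    and "\<And>w \<sigma>. w \<in> W \<Longrightarrow> \<sigma> \<in> G \<Longrightarrow> w \<circ> \<sigma> \<in> W"
    and "\<And>w \<sigma>. w \<in> W \<Longrightarrow> \<sigma> \<in> G \<Longrightarrow> f (w \<circ> \<sigma>) = f w"
    and "\<And>w. w \<in> W \<Longrightarrow> of_nat (card {\<sigma> \<in> G. w \<circ> \<sigma> = w}) dvd f w"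
  shows "of_nat (card G) dvd sum f W"
  using assms(2-5)
proof (induction W rule: finite_psubset_induct)
  case (psubset W)
  note g = sym_subgroupD[OF G]
  show ?case
  proof (cases "W = {}")
    case False
    then obtain w where w: "w \<in> W" by blast
    let ?O = "(\<circ>) w ` G"
    have O: "?O \<subseteq> W" using psubset.prems(1)[OF w] by (rule image_subsetI)
    have wO: "w \<in> ?O" using image_eqI[of w "(\<circ>) w" id G] g(2) by simp
    have "of_nat (card G) dvd sum f (W - ?O)"
    proof (rule psubset.IH)
      show "W - ?O \<subset> W" using w wO by blast
      \<comment> \<open>A word outside the orbit cannot enter it under \<sigma>, since undoing
        \<sigma> would stay in the orbit.\<close>
      show "u \<circ> \<sigma> \<in> W - ?O" if u: "u \<in> W - ?O" and \<sigma>: "\<sigma> \<in> G" for u \<sigma>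
      proof -
        have "u \<in> ?O" if "u \<circ> \<sigma> = w \<circ> \<tau>" "\<tau> \<in> G" for \<tau>
        proof -
          have "u = w \<circ> (\<tau> \<circ> inv' \<sigma>)"
            unfolding o_assoc that(1)[symmetric]
            by (simp only: comp_assoc permutes_inv_o(1)[OF g(1)[OF \<sigma>]] comp_id)
          then show ?thesis using g(3)[OF that(2) g(4)[OF \<sigma>]] by blast
        qed
        then show ?thesis using u \<sigma> psubset.prems(1)[of u \<sigma>] by blast
      qed
      show "f (u \<circ> \<sigma>) = f u" if "u \<in> W - ?O" "\<sigma> \<in> G" for u \<sigma>
        by (rule psubset.prems(2)) (use that in auto)
      show "of_nat (card {\<sigma> \<in> G. u \<circ> \<sigma> = u}) dvd f u" if "u \<in> W - ?O" for u
        by (rule psubset.prems(3)) (use that in auto)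
    qed
    moreover have "sum f ?O = of_nat (card ?O) * f w"
    proof -
      have "sum f ?O = (\<Sum>u\<in>?O. f w)"
      proof (rule sum.cong[OF refl])
        fix u assume "u \<in> ?O"
        then obtain \<sigma> where "\<sigma> \<in> G" "u = w \<circ> \<sigma>" by (rule imageE)
        then show "f u = f w" by (simp only: psubset.prems(2)[OF w])
      qed
      then show ?thesis by (simp only: sum_constant)
    qed
    moreover have "of_nat (card G) dvd of_nat (card ?O) * f w"
      unfolding card_orbit_stabilizer[OF G, of w, symmetric] of_nat_mult
      by (rule mult_dvd_mono[OF dvd_refl psubset.prems(3)[OF w]])
    moreover have "sum f W = sum f (W - ?O) + sum f ?O"
      by (rule sum.subset_diff[OF O psubset.hyps])
    ultimately show ?thesis by (simp only: dvd_add)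
  qed simp
qed

text \<open>The stabilizer is the Young subgroup of the fibres of \<open>w\<close> on
  \<open>Q\<close>. Every permutation of \<open>insert q Q\<close> is uniquely
  \<open>transpose q b \<circ> p\<close> with \<open>p\<close> permuting \<open>Q\<close>, and it
  fixes \<open>w\<close> iff \<open>w b = w q\<close> and \<open>p\<close> fixes \<open>w\<close>.
  So a new point multiplies the order by the size of its fibre. Values in \<open>T\<close> that are
  not attained contribute \<open>0! = 1\<close>.\<close>

lemma card_stabilizer_eq_prod_fact:
  assumes "finite Q" "finite T" "w ` Q \<subseteq> T"
  shows "card {\<sigma>. \<sigma> permutes Q \<and> w \<circ> \<sigma> = w} = (\<Prod>t\<in>T. fact (card {k \<in> Q. w k = t}))"
  using assms(1,3)
proof (induction Q)
  case empty
  have "{\<sigma>. \<sigma> permutes {} \<and> w \<circ> \<sigma> = w} = {id}" by auto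
  then show ?case by (simp only: card_1_singleton_iff) simp
next
  case (insert q Q)
  let ?S = "\<lambda>Q. {\<sigma>. \<sigma> permutes Q \<and> w \<circ> \<sigma> = w}"
  let ?E = "{b \<in> insert q Q. w b = w q}"
  let ?g = "\<lambda>(b, p). transpose q b \<circ> p"
  have fixed: "w \<circ> (transpose q b \<circ> p) = w \<longleftrightarrow> w b = w q \<and> w \<circ> p = w" if p: "p permutes Q" for b p
  proof -
    have *: "w \<circ> transpose q b = w" if "w b = w q"
      using that by (auto simp: transpose_def)
    have "w b = w q" if "w \<circ> (transpose q b \<circ> p) = w"
      using fun_cong[OF that, of q] permutes_not_in[OF p insert.hyps(2)] by simp
    moreover have "w \<circ> p = w" if "w \<circ> (transpose q b \<circ> p) = w" "w b = w q"
      using that(1) unfolding o_assoc *[OF that(2)] .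
    ultimately show ?thesis using * by (auto simp only: o_assoc)
  qed
  have inj: "inj_on ?g (?E \<times> ?S Q)"
  proof (rule inj_onI, clarify)
    fix b p c r assume p: "p permutes Q" "r permutes Q" and e: "transpose q b \<circ> p = transpose q c \<circ> r"
    have "b = c"
      using fun_cong[OF e, of q] permutes_not_in[OF p(1) insert.hyps(2)]
        permutes_not_in[OF p(2) insert.hyps(2)] by simp
    moreover have "p x = r x" for x
      using fun_cong[OF e, of x] transpose_involutory[of q c] unfolding \<open>b = c\<close> o_apply by metis
    ultimately show "b = c \<and> p = r" by blast
  qed
  have "?S (insert q Q) = {\<sigma> \<in> {p. p permutes insert q Q}. w \<circ> \<sigma> = w}" by blast
  also have "\<dots> = ?g ` (?E \<times> ?S Q)"
  proof (intro equalityI subsetI)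
    fix \<sigma> assume \<sigma>: "\<sigma> \<in> {\<sigma> \<in> {p. p permutes insert q Q}. w \<circ> \<sigma> = w}"
    then have "\<sigma> \<in> ?g ` {(b, p). b \<in> insert q Q \<and> p \<in> {p. p permutes Q}}"
      using permutes_insert[of q Q] by blast
    then obtain b p where p: "\<sigma> = transpose q b \<circ> p" "b \<in> insert q Q" "p permutes Q"
      unfolding image_iff by auto
    moreover have "w b = w q \<and> w \<circ> p = w"
      using fixed[OF p(3), of b] \<sigma> unfolding p(1) by blast
    ultimately show "\<sigma> \<in> ?g ` (?E \<times> ?S Q)" by (intro image_eqI[where x = "(b, p)"]) simp_all
  next
    fix \<sigma> assume "\<sigma> \<in> ?g ` (?E \<times> ?S Q)"
    then obtain b p where p: "\<sigma> = transpose q b \<circ> p" "b \<in> insert q Q" "p permutes Q"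
        "w b = w q \<and> w \<circ> p = w" unfolding image_iff by auto
    have "\<sigma> \<in> {p. p permutes insert q Q}"
      unfolding permutes_insert using p by (intro image_eqI[where x = "(b, p)"]) auto
    with fixed[OF p(3), of b] p show "\<sigma> \<in> {\<sigma> \<in> {p. p permutes insert q Q}. w \<circ> \<sigma> = w}"
      by blast
  qed
  finally have "card (?S (insert q Q)) = card ?E * card (?S Q)"
    using card_image[OF inj] by (simp add: card_cartesian_product)
  also have "\<dots> = card ?E * (\<Prod>t\<in>T. fact (card {k \<in> Q. w k = t}))"
    using insert.IH insert.prems by (simp only: insert_subset image_insert)
  \<comment> \<open>Only the factor at \<open>w q\<close> changes: it grows from \<open>m!\<close>
    to \<open>(m + 1)!\<close>, where \<open>m + 1\<close> is the size of \<open>?E\<close>.\<close>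
  also have "\<dots> = (\<Prod>t\<in>T. fact (card {k \<in> insert q Q. w k = t}))"
  proof -
    have T: "finite T" "w q \<in> T" using assms(2) insert.prems by auto
    have a: "?E = insert q {k \<in> Q. w k = w q}" by auto
    have b: "card ?E = Suc (card {k \<in> Q. w k = w q})"
      unfolding a using insert.hyps by simp
    have c: "{k \<in> insert q Q. w k = t} = {k \<in> Q. w k = t}" if "t \<noteq> w q" for t
      using that by auto
    have p: "(\<Prod>t\<in>T - {w q}. fact (card {k \<in> insert q Q. w k = t})) =
        (\<Prod>t\<in>T - {w q}. fact (card {k \<in> Q. w k = t}) :: nat)"
      using c by (intro prod.cong) auto
    show ?thesis
      unfolding prod.remove[OF T] b p by (simp only: fact_Suc mult.assoc of_nat_id)
  qed
  finally show ?case .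
qed


section \<open>The sign of a permutation on the odd positions\<close>

text \<open>The pairs \<open>i < j\<close> stand for two-element subsets. As \<sigma> may reverse a
  pair, the bijection sorts the images with \<open>min\<close> and \<open>max\<close>, and the
  symmetry of \<open>g\<close> makes the sorting harmless.\<close>

lemma prod_less_pairs_reindex:
  fixes g :: "nat \<Rightarrow> nat \<Rightarrow> 'r::comm_monoid_mult"
  assumes sym: "\<And>i j. g i j = g j i" and \<sigma>: "\<sigma> permutes S"
  shows "(\<Prod>(i, j)\<in>{(i, j). i \<in> \<sigma> ` K \<and> j \<in> \<sigma> ` K \<and> i < j}. g (inv' \<sigma> i) (inv' \<sigma> j)) =
    (\<Prod>(i, j)\<in>{(i, j). i \<in> K \<and> j \<in> K \<and> i < j}. g i j)"
proof -
  let ?m = "\<lambda>\<rho> (i, j). (min (\<rho> i) (\<rho> j), max (\<rho> i) (\<rho> j :: nat))"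
  have inv [simp]: "inv' \<sigma> (\<sigma> x) = x" "\<sigma> (inv' \<sigma> x) = x" for x
    using permutes_inverses[OF \<sigma>] by auto
  have inj: "\<sigma> x = \<sigma> y \<longleftrightarrow> x = y" for x y by (metis inv(1))
  show ?thesis
    by (rule prod.reindex_bij_witness[where i = "?m \<sigma>" and j = "?m (inv' \<sigma>)"])
      (auto simp: min_def max_def inj sym intro: le_neq_implies_less split: if_splits)
qed

context superalgebra
begin

text \<open>The sign is kept per pair because it obeys a chain rule: for
  \<open>\<tau> \<circ> \<sigma>\<close> it is the sign for \<sigma> at \<open>i\<close>,
  \<open>j\<close> times the sign for \<tau> at \<open>\<sigma> i\<close>,
  \<open>\<sigma> j\<close>. Numbers of inversions add up only modulo 2.\<close>

definition pair_sign :: "(nat \<Rightarrow> nat) \<Rightarrow> nat \<Rightarrow> nat \<Rightarrow> 'k" where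
  "pair_sign \<rho> i j = (if (i < j) = (\<rho> i < \<rho> j) then 1 else -1)"

definition odd_sign :: "nat \<Rightarrow> (nat \<Rightarrow> nat) \<Rightarrow> (nat \<Rightarrow> bool) \<Rightarrow> 'k" where
  "odd_sign d \<sigma> p = (-1) ^ inversions d \<sigma> p"

lemma inversions_cong:
  "(\<And>k. k \<in> {1..d} \<Longrightarrow> p k = q k) \<Longrightarrow> inversions d \<sigma> p = inversions d \<sigma> q"
  unfolding inversions_def by (rule arg_cong[of _ _ card]) auto

text \<open>Each inversion among the odd positions \<open>K\<close> gives a factor -1, and every
  other pair gives 1.\<close>

lemma odd_sign_eq_prod:
  fixes p :: "nat \<Rightarrow> bool"
  assumes \<sigma>: "\<sigma> permutes {1..d}"
  defines "K \<equiv> {k \<in> {1..d}. p k}"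
  shows "odd_sign d \<sigma> p =
    (\<Prod>(i, j)\<in>{(i, j). i \<in> K \<and> j \<in> K \<and> i < j}. pair_sign (inv' \<sigma>) i j)"
proof -
  let ?U = "{(i, j). i \<in> K \<and> j \<in> K \<and> i < j}"
  have fin: "finite ?U"
    by (rule finite_subset[of _ "{1..d} \<times> {1..d}"]) (auto simp: K_def)
  have inj: "inv' \<sigma> x = inv' \<sigma> y \<longleftrightarrow> x = y" for x y
    by (metis permutes_inverses(1)[OF \<sigma>])
  have "(\<Prod>(i, j)\<in>?U. pair_sign (inv' \<sigma>) i j) =
      (\<Prod>ij\<in>?U. if inv' \<sigma> (fst ij) > inv' \<sigma> (snd ij) then -1 else 1)"
    by (rule prod.cong) (auto simp: pair_sign_def not_less_iff_gr_or_eq inj)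
  also have "\<dots> = (-1) ^ card (?U \<inter> {ij. inv' \<sigma> (fst ij) > inv' \<sigma> (snd ij)})"
    using fin by (simp add: prod.If_cases)
  also have "?U \<inter> {ij. inv' \<sigma> (fst ij) > inv' \<sigma> (snd ij)} =
      {(k, l). k \<in> {1..d} \<and> l \<in> {1..d} \<and> k < l \<and> inv' \<sigma> k > inv' \<sigma> l \<and> p k \<and> p l}"
    by (auto simp: K_def)
  finally show ?thesis unfolding odd_sign_def inversions_def by simp
qed

text \<open>\<sigma> carries the odd positions \<open>L\<close> of \<open>p \<circ> \<sigma>\<close>
  to the odd positions \<open>K\<close> of \<open>p\<close>. The chain rule for
  \<open>inv' \<tau> \<circ> inv' \<sigma>\<close> splits the product over the pairs in
  \<open>K\<close>, and its second factor is reindexed by the pairs in \<open>L\<close>.\<close>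

lemma odd_sign_comp:
  assumes \<sigma>: "\<sigma> permutes {1..d}" and \<tau>: "\<tau> permutes {1..d}"
  shows "odd_sign d (\<sigma> \<circ> \<tau>) p = odd_sign d \<sigma> p * odd_sign d \<tau> (p \<circ> \<sigma>)"
proof -
  let ?U = "\<lambda>K. {(i, j). i \<in> K \<and> j \<in> K \<and> i < j}"
  define K where "K = {k \<in> {1..d}. p k}"
  define L where "L = {k \<in> {1..d}. (p \<circ> \<sigma>) k}"
  have K: "K = \<sigma> ` L"
  proof
    show "K \<subseteq> \<sigma> ` L"
    proof
      fix k assume k: "k \<in> K"
      have "inv' \<sigma> k \<in> L"
        using k permutes_in_image[OF permutes_inv[OF \<sigma>], of k] permutes_inverses(1)[OF \<sigma>, of k]
        by (simp add: K_def L_def)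
      then show "k \<in> \<sigma> ` L" using permutes_inverses(1)[OF \<sigma>, of k] by (metis imageI)
    qed
    show "\<sigma> ` L \<subseteq> K" using permutes_in_image[OF \<sigma>] by (auto simp: K_def L_def simp del: atLeastAtMost_iff)
  qed
  have inj: "inv' \<sigma> x = inv' \<sigma> y \<longleftrightarrow> x = y" "inv' \<tau> x = inv' \<tau> y \<longleftrightarrow> x = y" for x y
    by (metis permutes_inverses(1)[OF \<sigma>], metis permutes_inverses(1)[OF \<tau>])
  have sym: "pair_sign (inv' \<tau>) i j = pair_sign (inv' \<tau>) j i" for i j
    using inj(2)[of i j] by (cases "i = j") (auto simp: pair_sign_def not_less_iff_gr_or_eq)
  have "odd_sign d (\<sigma> \<circ> \<tau>) p = (\<Prod>(i, j)\<in>?U K. pair_sign (inv' (\<sigma> \<circ> \<tau>)) i j)"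
    unfolding K_def by (rule odd_sign_eq_prod[OF permutes_compose[OF \<tau> \<sigma>]])
  also have "inv' (\<sigma> \<circ> \<tau>) = inv' \<tau> \<circ> inv' \<sigma>"
    using permutes_bij[OF \<sigma>] permutes_bij[OF \<tau>] by (rule o_inv_distrib)
  also have "(\<Prod>(i, j)\<in>?U K. pair_sign (inv' \<tau> \<circ> inv' \<sigma>) i j) =
      (\<Prod>(i, j)\<in>?U K. pair_sign (inv' \<sigma>) i j * pair_sign (inv' \<tau>) (inv' \<sigma> i) (inv' \<sigma> j))"
    by (rule prod.cong) (auto simp: pair_sign_def)
  also have "\<dots> = (\<Prod>(i, j)\<in>?U K. pair_sign (inv' \<sigma>) i j) *
      (\<Prod>(i, j)\<in>?U K. pair_sign (inv' \<tau>) (inv' \<sigma> i) (inv' \<sigma> j))"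
    by (simp add: prod.distrib case_prod_unfold)
  also have "(\<Prod>(i, j)\<in>?U K. pair_sign (inv' \<tau>) (inv' \<sigma> i) (inv' \<sigma> j)) =
      (\<Prod>(i, j)\<in>?U L. pair_sign (inv' \<tau>) i j)"
    unfolding K using sym \<sigma> by (rule prod_less_pairs_reindex)
  finally show ?thesis
    unfolding K_def L_def odd_sign_eq_prod[OF \<sigma>] odd_sign_eq_prod[OF \<tau>] .
qed

text \<open>Only pairs of odd positions count as inversions, and these positions do not
  move.\<close>

lemma odd_sign_fixed:
  assumes \<sigma>: "\<sigma> permutes {1..d}" and "\<And>k. k \<in> {1..d} \<Longrightarrow> p k \<Longrightarrow> \<sigma> k = k"
  shows "odd_sign d \<sigma> p = 1"
proof -
  have "inv' \<sigma> k = k" if "k \<in> {1..d}" "p k" for k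
    using assms(2)[OF that] permutes_inverses(2)[OF \<sigma>] by metis
  then have "inversions d \<sigma> p = 0"
    unfolding inversions_def by (auto intro!: card_eq_0_iff[THEN iffD2])
  then show ?thesis by (simp add: odd_sign_def)
qed

text \<open>Besides \<open>(k, l)\<close> itself, each odd position \<open>m\<close> strictly
  between \<open>k\<close> and \<open>l\<close> gives the two inversions \<open>(k, m)\<close> and
  \<open>(m, l)\<close>, so the total is odd.\<close>

lemma odd_sign_transpose:
  assumes kl: "k \<in> {1..d}" "l \<in> {1..d}" "k < l" "p k" "p l"
  shows "odd_sign d (transpose k l) p = -1"
proof -
  let ?M = "{m \<in> {k<..<l}. p m}"
  have "{(i, j). i \<in> {1..d} \<and> j \<in> {1..d} \<and> i < j \<and>
        inv' (transpose k l) i > inv' (transpose k l) j \<and> p i \<and> p j} =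
      insert (k, l) (Pair k ` ?M \<union> (\<lambda>m. (m, l)) ` ?M)" (is "?L = ?R")
  proof (rule Set.set_eqI)
    fix x :: "nat \<times> nat"
    obtain i j where x: "x = (i, j)" by (cases x)
    have R: "x \<in> ?R \<longleftrightarrow> i = k \<and> j = l \<or> i = k \<and> k < j \<and> j < l \<and> p j \<or> j = l \<and> k < i \<and> i < l \<and> p i"
      unfolding x by auto
    have L: "x \<in> ?L \<longleftrightarrow> i \<in> {1..d} \<and> j \<in> {1..d} \<and> i < j \<and>
        transpose k l i > transpose k l j \<and> p i \<and> p j"
      unfolding x by simp
    consider "i = k" "j = k" | "i = k" "j = l" | "i = k" "j \<noteq> k" "j \<noteq> l" | "i = l"
      | "i \<noteq> k" "i \<noteq> l" "j = k" | "i \<noteq> k" "i \<noteq> l" "j = l"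
      | "i \<noteq> k" "i \<noteq> l" "j \<noteq> k" "j \<noteq> l" by blast
    then show "x \<in> ?L \<longleftrightarrow> x \<in> ?R"
      unfolding L R by cases (use kl in \<open>auto simp: transpose_def\<close>)
  qed
  moreover have "card (Pair k ` ?M \<union> (\<lambda>m. (m, l)) ` ?M) = card ?M + card ?M"
    using kl(3) by (subst card_Un_disjoint) (auto simp: card_image inj_on_def)
  then have "card (insert (k, l) (Pair k ` ?M \<union> (\<lambda>m. (m, l)) ` ?M)) = Suc (card ?M + card ?M)"
    by (subst card_insert_disjoint) auto
  ultimately have "inversions d (transpose k l) p = Suc (card ?M + card ?M)"
    unfolding inversions_def by (simp only:)
  then show ?thesis by (simp add: odd_sign_def power_add flip: power_mult_distrib)
qed

end

section \<open>Coordinates on the tensor power\<close>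

interpretation fmod: module "fscale :: 'k::comm_ring_1 \<Rightarrow> ('w \<Rightarrow>\<^sub>0 'k) \<Rightarrow> _"
  by (rule module_fscale)

lemma keys_fscale: "Poly_Mapping.keys (fscale c v) \<subseteq> Poly_Mapping.keys v"
  by (auto simp: in_keys_iff)

lemma poly_mapping_eq_sum_pure:
  "v = (\<Sum>x\<in>Poly_Mapping.keys v. fscale (Poly_Mapping.lookup v x) (pure x))"
proof (rule poly_mapping_eqI)
  fix y
  have "(\<Sum>x\<in>Poly_Mapping.keys v. Poly_Mapping.lookup v x * Poly_Mapping.lookup (pure x) y) =
      (\<Sum>x\<in>Poly_Mapping.keys v. if x = y then Poly_Mapping.lookup v x else 0)"
    by (rule sum.cong) (auto simp: pure_def lookup_single when_def)
  then show "Poly_Mapping.lookup v y =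
      Poly_Mapping.lookup (\<Sum>x\<in>Poly_Mapping.keys v. fscale (Poly_Mapping.lookup v x) (pure x)) y"
    by (simp add: lookup_sum in_keys_iff)
qed

lemma words_comp:
  assumes "w \<in> words d X" "\<sigma> permutes {1..d}"
  shows "w \<circ> \<sigma> \<in> words d X"
  using assms(1) permutes_in_image[OF assms(2)] permutes_not_in[OF assms(2)]
  unfolding words_def by (intro PiE_I) (auto simp del: atLeastAtMost_iff dest: PiE_mem PiE_arb)

context superalgebra
begin

section \<open>Congruence modulo the multilinearity relations, and expansion of pure tensors\<close>

definition tensor_eq ::
  "nat \<Rightarrow> ((nat \<Rightarrow> 'a^'n^'n) \<Rightarrow>\<^sub>0 'k) \<Rightarrow> ((nat \<Rightarrow> 'a^'n^'n) \<Rightarrow>\<^sub>0 'k) \<Rightarrow> bool" where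
  "tensor_eq d u v \<longleftrightarrow> u - v \<in> tensor_null d"

lemma tensor_eq_refl: "tensor_eq d v v"
  by (simp add: tensor_eq_def tensor_null_def fmod.span_zero)

lemma tensor_eq_sym: "tensor_eq d u v \<Longrightarrow> tensor_eq d v u"
  using fmod.span_neg[of "u - v" "tensor_relations d"] by (simp add: tensor_eq_def tensor_null_def)

lemma tensor_eq_trans [trans]: "tensor_eq d u v \<Longrightarrow> tensor_eq d v w \<Longrightarrow> tensor_eq d u w"
  using fmod.span_add[of "u - v" "tensor_relations d" "v - w"]
  by (simp add: tensor_eq_def tensor_null_def)

lemma tensor_eq_add: "tensor_eq d u v \<Longrightarrow> tensor_eq d u' v' \<Longrightarrow> tensor_eq d (u + u') (v + v')"
  using fmod.span_add[of "u - v" "tensor_relations d" "u' - v'"]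
  by (simp add: tensor_eq_def tensor_null_def algebra_simps)

lemma tensor_eq_fscale: "tensor_eq d u v \<Longrightarrow> tensor_eq d (fscale c u) (fscale c v)"
  using fmod.span_scale[of "u - v" "tensor_relations d" c]
  by (simp add: tensor_eq_def tensor_null_def fmod.scale_right_diff_distrib)

lemma tensor_eq_sum:
  "(\<And>i. i \<in> S \<Longrightarrow> tensor_eq d (f i) (g i)) \<Longrightarrow> tensor_eq d (sum f S) (sum g S)"
  by (induction S rule: infinite_finite_induct) (auto simp: tensor_eq_refl intro: tensor_eq_add)

lemma tclass_eq_iff: "tclass d u = tclass d v \<longleftrightarrow> tensor_eq d u v"
proof
  assume "tclass d u = tclass d v"
  moreover have "u \<in> tclass d u" using tensor_eq_refl by (simp add: tclass_def tensor_eq_def)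
  ultimately show "tensor_eq d u v" by (simp add: tclass_def tensor_eq_def)
next
  assume "tensor_eq d u v"
  then show "tclass d u = tclass d v"
    using tensor_eq_trans tensor_eq_sym unfolding tclass_def tensor_eq_def by blast
qed

lemma tensor_eq_pure_add:
  assumes "x \<in> words d UNIV" "i \<in> {1..d}"
  shows "tensor_eq d (pure (x(i := X + Y))) (pure (x(i := X)) + pure (x(i := Y)))"
proof -
  have "pure (x(i := X + Y)) - pure (x(i := X)) - pure (x(i := Y)) \<in> tensor_relations d"
    unfolding tensor_relations_def using assms by blast
  then show ?thesis
    by (simp add: tensor_eq_def tensor_null_def fmod.span_base diff_diff_eq)
qed

lemma tensor_eq_pure_mscale:
  assumes "x \<in> words d UNIV" "i \<in> {1..d}"
  shows "tensor_eq d (pure (x(i := mscale c X))) (fscale c (pure (x(i := X))))"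
proof -
  have "pure (x(i := mscale c X)) - fscale c (pure (x(i := X))) \<in> tensor_relations d"
    unfolding tensor_relations_def using assms by blast
  then show ?thesis
    by (simp add: tensor_eq_def tensor_null_def fmod.span_base)
qed

lemma tensor_eq_pure_sum:
  assumes x: "x \<in> words d UNIV" and i: "i \<in> {1..d}" and "finite F"
  shows "tensor_eq d (pure (x(i := \<Sum>j\<in>F. mscale (c j) (e j))))
    (\<Sum>j\<in>F. fscale (c j) (pure (x(i := e j))))"
  using \<open>finite F\<close>
proof induction
  case empty
  have "pure (x(i := 0)) \<in> tensor_null d"
    using x i by (intro pure_zero_in_null[of _ d i]) (auto simp: words_def PiE_iff extensional_def)
  then show ?case by (simp only: tensor_eq_def sum.empty diff_0_right)
next
  case (insert j F)
  show ?case
    unfolding sum.insert[OF insert.hyps]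
    by (rule tensor_eq_trans[OF tensor_eq_pure_add[OF x i]
          tensor_eq_add[OF tensor_eq_pure_mscale[OF x i] insert.IH]])
qed

text \<open>Multilinear expansion, one position at a time. \<open>K\<close> is the set of positions
  already expanded, and the other factors of \<open>x\<close> are left alone. The sum over
  \<open>insert i K\<close> arises because a function there is a value \<open>j\<close> at
  \<open>i\<close> together with a function on \<open>K\<close>.\<close>

lemma tensor_eq_pure_expand:
  assumes "finite K" "K \<subseteq> {1..d}" "finite F" "x \<in> words d UNIV"
    and "\<And>k. k \<in> K \<Longrightarrow> x k = (\<Sum>j\<in>F. mscale (c k j) (e j))"
  shows "tensor_eq d (pure x)
    (\<Sum>f\<in>K \<rightarrow>\<^sub>E F. fscale (\<Prod>k\<in>K. c k (f k)) (pure (\<lambda>k. if k \<in> K then e (f k) else x k)))"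
  using assms(1,2,4,5)
proof (induction K arbitrary: x)
  case empty
  then show ?case by (simp add: tensor_eq_refl)
next
  case (insert i K)
  let ?w = "\<lambda>K x f k. if k \<in> K then e (f k) else x k"
  have i: "i \<in> {1..d}" using insert.prems by simp
  have x: "x = x(i := \<Sum>j\<in>F. mscale (c i j) (e j))"
    using insert.prems(3)[of i] by (simp add: fun_upd_idem)
  have "tensor_eq d (pure x) (\<Sum>j\<in>F. fscale (c i j) (pure (x(i := e j))))"
    by (subst x) (rule tensor_eq_pure_sum[OF insert.prems(2) i \<open>finite F\<close>])
  also have "tensor_eq d (\<Sum>j\<in>F. fscale (c i j) (pure (x(i := e j))))
    (\<Sum>j\<in>F. fscale (c i j) (\<Sum>f\<in>K \<rightarrow>\<^sub>E F.
      fscale (\<Prod>k\<in>K. c k (f k)) (pure (?w K (x(i := e j)) f))))"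
  proof (rule tensor_eq_sum, rule tensor_eq_fscale, rule insert.IH)
    fix j
    show "x(i := e j) \<in> words d UNIV"
      using insert.prems(2) i by (auto simp: words_def PiE_iff extensional_def)
    show "(x(i := e j)) k = (\<Sum>j\<in>F. mscale (c k j) (e j))" if "k \<in> K" for k
      using that insert.prems(3)[of k] insert.hyps(2) by auto
  qed (use insert.prems in simp)
  also have "(\<Sum>j\<in>F. fscale (c i j) (\<Sum>f\<in>K \<rightarrow>\<^sub>E F.
      fscale (\<Prod>k\<in>K. c k (f k)) (pure (?w K (x(i := e j)) f)))) =
    (\<Sum>(j, f)\<in>F \<times> (K \<rightarrow>\<^sub>E F). fscale (\<Prod>k\<in>insert i K. c k ((f(i := j)) k))
      (pure (?w (insert i K) x (f(i := j)))))"
    unfolding sum.cartesian_product[symmetric] fmod.scale_sum_right fmod.scale_scale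
  proof (intro sum.cong refl arg_cong2[of _ _ _ _ fscale] arg_cong[of _ _ pure] ext)
    fix j f k
    show "c i j * (\<Prod>k\<in>K. c k (f k)) = (\<Prod>k\<in>insert i K. c k ((f(i := j)) k))"
    proof -
      have "(\<Prod>k\<in>K. c k ((f(i := j)) k)) = (\<Prod>k\<in>K. c k (f k))"
        using insert.hyps by (intro prod.cong) auto
      then show ?thesis using insert.hyps by simp
    qed
    show "?w K (x(i := e j)) f k = ?w (insert i K) x (f(i := j)) k"
      using insert.hyps by auto
  qed
  also have "\<dots> = (\<Sum>f\<in>insert i K \<rightarrow>\<^sub>E F. fscale (\<Prod>k\<in>insert i K. c k (f k))
      (pure (?w (insert i K) x f)))"
    unfolding PiE_insert_eq
    by (subst sum.reindex[OF inj_combinator[OF insert.hyps(2)]]) (simp add: case_prod_unfold)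
  finally show ?case .
qed

text \<open>Letters are triples \<open>(b, r, s)\<close>. When \<open>b\<close> runs over a basis of
  the algebra, these matrices form a basis of the matrix algebra.\<close>

definition basis_mat :: "'a \<times> 'n \<times> 'n \<Rightarrow> 'a^'n^'n" where
  "basis_mat i = munit (fst i) (fst (snd i)) (snd (snd i))"

definition basis_word :: "nat \<Rightarrow> (nat \<Rightarrow> 'a \<times> 'n \<times> 'n) \<Rightarrow> nat \<Rightarrow> 'a^'n^'n" where
  "basis_word d w = (\<lambda>k\<in>{1..d}. basis_mat (w k))"

end

section \<open>Coordinates with respect to a basis of homogeneous elements\<close>

locale parity_basis = superalgebra scale A0 A1
  for scale :: "'k::{idom,ring_char_0} \<Rightarrow> 'a::ring \<Rightarrow> 'a" (infixr \<open>\<cdot>\<close> 75)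
    and A0 A1 :: "'a set" +
  fixes B0 B1 :: "'a set"
  assumes basis_B: "basis_of (B0 \<union> B1) UNIV"
    and B0_subset: "B0 \<subseteq> A0" and B1_subset: "B1 \<subseteq> A1" and B0_B1_disjoint: "B0 \<inter> B1 = {}"
begin

abbreviation B :: "'a set" where "B \<equiv> B0 \<union> B1"

lemma independent_B: "independent B" and in_span_B [simp]: "a \<in> span B"
  using basis_B by (auto simp: basis_of_def)

text \<open>Sort the expansion of \<open>a\<close> by parity: \<open>y q\<close> collects the basis
  vectors of parity \<open>q\<close>. As \<open>y False\<close> is even and \<open>y True\<close> is
  odd, uniqueness of the decomposition identifies \<open>y q\<close> with
  \<open>part q a\<close>.\<close>

lemma representation_part:
  "representation B (part q a) b = (if q = (b \<in> B1) then representation B a b else 0)"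
proof -
  let ?r = "representation B a"
  let ?S = "{b. ?r b \<noteq> 0}"
  have fin: "finite ?S" by (rule finite_representation)
  have SB: "?S \<subseteq> B" using representation_ne_zero by blast
  define f where "f q = (\<lambda>b. if q = (b \<in> B1) then ?r b else 0)" for q
  define y where "y q = (\<Sum>b\<in>{b. f q b \<noteq> 0}. f q b \<cdot> b)" for q
  have S: "{b. f q b \<noteq> 0} = {b \<in> ?S. q = (b \<in> B1)}" for q by (auto simp: f_def)
  have r: "representation B (y q) = f q" for q
    using SB fin independent_B in_span_B y_def S by (intro representation_eqI) (auto simp: f_def)
  have "y True \<in> A1"
    unfolding y_def S using B1_subset by (intro subspace_sum subspace_scale subspace_A1) auto
  moreover have "y False \<in> A0"
    unfolding y_def S using B0_subset SB by (intro subspace_sum subspace_scale subspace_A0) auto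
  moreover have "a = y False + y True"
  proof -
    have "a = (\<Sum>b\<in>?S. ?r b \<cdot> b)"
      by (rule sum_nonzero_representation_eq[OF independent_B in_span_B, symmetric])
    also have "?S = {b. f False b \<noteq> 0} \<union> {b. f True b \<noteq> 0}" unfolding S by auto
    also have "(\<Sum>b\<in>\<dots>. ?r b \<cdot> b) = (\<Sum>b\<in>{b. f False b \<noteq> 0}. ?r b \<cdot> b) + (\<Sum>b\<in>{b. f True b \<noteq> 0}. ?r b \<cdot> b)"
      using fin unfolding S by (intro sum.union_disjoint) auto
    also have "\<dots> = y False + y True"
      unfolding y_def by (intro arg_cong2[of _ _ _ _ "(+)"] sum.cong) (auto simp: f_def split: if_splits)
    finally show ?thesis .
  qed
  ultimately have "part q a = y q"
    using part_unique[of "y False" "y True"] by (cases q) auto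
  then show ?thesis by (simp add: r f_def)
qed

definition mat_coord :: "'a \<times> 'n \<times> 'n \<Rightarrow> 'a^'n^'n \<Rightarrow> 'k" where
  "mat_coord i X = representation B (X $ fst (snd i) $ snd (snd i)) (fst i)"

text \<open>A linear form on the free module, given on a pure word by the product of the coordinates
  of its factors. It descends to the tensor power by \<open>word_coord_null\<close>.\<close>

definition word_coord :: "nat \<Rightarrow> (nat \<Rightarrow> 'a \<times> 'n \<times> 'n) \<Rightarrow> ((nat \<Rightarrow> 'a^'n^'n) \<Rightarrow>\<^sub>0 'k) \<Rightarrow> 'k" where
  "word_coord d w v =
    (\<Sum>x\<in>Poly_Mapping.keys v. Poly_Mapping.lookup v x * (\<Prod>k\<in>{1..d}. mat_coord (w k) (x k)))"

definition odd_at :: "(nat \<Rightarrow> 'a \<times> 'n \<times> 'n) \<Rightarrow> nat \<Rightarrow> bool" where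
  "odd_at w k \<longleftrightarrow> fst (w k) \<in> B1"

lemma odd_at_comp: "odd_at (w \<circ> \<sigma>) = odd_at w \<circ> \<sigma>"
  by (auto simp: odd_at_def)

lemma mat_coord_add: "mat_coord i (X + Y) = mat_coord i X + mat_coord i Y"
  by (simp add: mat_coord_def representation_add[OF independent_B])

lemma mat_coord_mscale: "mat_coord i (mscale c X) = c * mat_coord i X"
  by (simp add: mat_coord_def mscale_def representation_scale[OF independent_B])

lemma mat_coord_mpart: "mat_coord i (mpart q X) = (if q = (fst i \<in> B1) then mat_coord i X else 0)"
  by (simp add: mat_coord_def mpart_def representation_part)

lemma mat_coord_basis_mat:
  "j \<in> B \<times> UNIV \<Longrightarrow> mat_coord i (basis_mat j) = (if i = j then 1 else 0)"
  by (cases i; cases j)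
    (auto simp: mat_coord_def basis_mat_def munit_def representation_basis[OF independent_B]
      representation_zero)

text \<open>The basis may be infinite, so the sum runs over a finite part \<open>C\<close> that
  contains every basis element occurring in the entries of \<open>X\<close>.\<close>

lemma mat_expand:
  fixes X :: "'a^'n::finite^'n"
  assumes "finite C" "C \<subseteq> B" "\<And>i. mat_coord i X \<noteq> 0 \<Longrightarrow> fst i \<in> C"
  shows "X = (\<Sum>i\<in>C \<times> UNIV. mscale (mat_coord i X) (basis_mat i))"
proof -
  have "(\<Sum>i\<in>C \<times> UNIV. mscale (mat_coord i X) (basis_mat i)) $ r $ s = X $ r $ s" for r s
  proof -
    have "(\<Sum>i\<in>C \<times> UNIV. mscale (mat_coord i X) (basis_mat i)) $ r $ s =
        (\<Sum>i\<in>C \<times> UNIV. if snd i = (r, s) then mat_coord i X \<cdot> fst i else 0)"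
      by (auto simp: basis_mat_def munit_def mscale_def intro!: sum.cong)
    also have "\<dots> = (\<Sum>b\<in>C. mat_coord (b, r, s) X \<cdot> b)"
      by (simp add: sum.cartesian_product')
    also have "\<dots> = (\<Sum>b\<in>C. representation B (X $ r $ s) b \<cdot> b)"
      by (simp add: mat_coord_def)
    also have "\<dots> = (\<Sum>b | representation B (X $ r $ s) b \<noteq> 0. representation B (X $ r $ s) b \<cdot> b)"
      using assms(3)[of "(_, r, s)"]
      by (intro sum.mono_neutral_right[OF assms(1)]) (auto simp: mat_coord_def)
    also have "\<dots> = X $ r $ s"
      by (rule sum_nonzero_representation_eq[OF independent_B in_span_B])
    finally show ?thesis .
  qed
  then show ?thesis by (simp add: vec_eq_iff)
qed

lemma word_coord_superset:
  assumes "finite K" "Poly_Mapping.keys v \<subseteq> K"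
  shows "word_coord d w v =
    (\<Sum>x\<in>K. Poly_Mapping.lookup v x * (\<Prod>k\<in>{1..d}. mat_coord (w k) (x k)))"
  unfolding word_coord_def using assms
  by (intro sum.mono_neutral_left) (auto simp: in_keys_iff)

lemma word_coord_add: "word_coord d w (u + v) = word_coord d w u + word_coord d w v"
proof -
  let ?K = "Poly_Mapping.keys u \<union> Poly_Mapping.keys v"
  have "finite ?K" "Poly_Mapping.keys (u + v) \<subseteq> ?K" using keys_add[of u v] by auto
  then show ?thesis
    by (subst (1 2 3) word_coord_superset[of ?K]) (auto simp: lookup_add distrib_right sum.distrib)
qed

lemma word_coord_fscale: "word_coord d w (fscale c v) = c * word_coord d w v"
  by (subst word_coord_superset[OF finite_keys keys_fscale])
    (simp add: word_coord_def sum_distrib_left mult.assoc)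

lemma word_coord_zero [simp]: "word_coord d w 0 = 0"
  by (simp add: word_coord_def)

lemma word_coord_diff: "word_coord d w (u - v) = word_coord d w u - word_coord d w v"
  using word_coord_add[of d w "u - v" v] by (simp add: algebra_simps)

lemma word_coord_sum: "word_coord d w (sum f S) = (\<Sum>s\<in>S. word_coord d w (f s))"
  by (induction S rule: infinite_finite_induct) (auto simp: word_coord_add)

lemma word_coord_pure: "word_coord d w (pure x) = (\<Prod>k\<in>{1..d}. mat_coord (w k) (x k))"
  by (simp add: word_coord_def pure_def)

lemma word_coord_pure_upd:
  assumes "i \<in> {1..d}"
  shows "word_coord d w (pure (x(i := X))) =
    mat_coord (w i) X * (\<Prod>k\<in>{1..d} - {i}. mat_coord (w k) (x k))"
  unfolding word_coord_pure by (subst prod.remove[OF _ assms]) auto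

text \<open>The kernel of a linear form is a submodule, and it contains the generating relations
  because the factor at position \<open>i\<close> depends linearly on the matrix placed
  there.\<close>

lemma word_coord_null:
  assumes "v \<in> tensor_null d"
  shows "word_coord d w v = 0"
proof -
  have "fmod.subspace {v. word_coord d w v = 0}"
    by (auto simp: fmod.subspace_def word_coord_add word_coord_fscale)
  moreover have "word_coord d w (pure (x(i := X + Y)) - pure (x(i := X)) - pure (x(i := Y))) = 0"
    "word_coord d w (pure (x(i := mscale c X)) - fscale c (pure (x(i := X)))) = 0"
    if "i \<in> {1..d}" for x i X Y c
    unfolding word_coord_diff word_coord_fscale word_coord_pure_upd[OF that]
    by (simp_all add: mat_coord_add mat_coord_mscale algebra_simps)
  then have "tensor_relations d \<subseteq> {v. word_coord d w v = 0}"
    unfolding tensor_relations_def by auto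
  ultimately show ?thesis
    using fmod.span_minimal assms unfolding tensor_null_def by blast
qed

lemma word_coord_tensor_eq: "tensor_eq d u v \<Longrightarrow> word_coord d w u = word_coord d w v"
  using word_coord_null[of "u - v" d w] by (simp add: tensor_eq_def word_coord_diff)

text \<open>The coordinate forms are dual to the basis words, so distinct basis words stay linearly
  independent in the tensor power.\<close>

lemma word_coord_basis_word:
  assumes "w \<in> words d (B \<times> UNIV)" "w' \<in> words d (B \<times> UNIV)"
  shows "word_coord d w (pure (basis_word d w')) = (if w = w' then 1 else 0)"
proof -
  have "word_coord d w (pure (basis_word d w')) = (\<Prod>k\<in>{1..d}. if w k = w' k then 1 else 0)"
    unfolding word_coord_pure using assms(2)
    by (intro prod.cong) (auto simp: basis_word_def words_def mat_coord_basis_mat dest!: PiE_mem)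
  also have "\<dots> = (if \<forall>k\<in>{1..d}. w k = w' k then 1 else 0)"
    by (cases "\<forall>k\<in>{1..d}. w k = w' k") (auto intro!: prod.neutral)
  also have "(\<forall>k\<in>{1..d}. w k = w' k) \<longleftrightarrow> w = w'"
    using assms PiE_ext[of w "{1..d}" "\<lambda>_. B \<times> UNIV" w'] unfolding words_def by blast
  finally show ?thesis .
qed

text \<open>\<open>C\<close> collects the basis elements occurring in any entry of any factor of a
  word in the support of \<open>v\<close>. This is a finite set, so all words of \<open>v\<close>
  can be expanded over it at once.\<close>

lemma tensor_expand:
  fixes v :: "(nat \<Rightarrow> 'a^'n::finite^'n) \<Rightarrow>\<^sub>0 'k"
  assumes "Poly_Mapping.keys v \<subseteq> words d UNIV"
  obtains C where "finite C" "C \<subseteq> B"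
    "tensor_eq d v
      (\<Sum>w\<in>words d (C \<times> UNIV). fscale (word_coord d w v) (pure (basis_word d w)))"
proof -
  define C where "C = (\<Union>x\<in>Poly_Mapping.keys v. \<Union>k\<in>{1..d}. \<Union>r. \<Union>s.
    {b. representation B (x k $ r $ s) b \<noteq> 0})"
  have fin: "finite C" unfolding C_def by (auto intro: finite_representation)
  have CB: "C \<subseteq> B" unfolding C_def using representation_ne_zero by blast
  have pure: "tensor_eq d (pure x)
      (\<Sum>w\<in>words d (C \<times> UNIV). fscale (word_coord d w (pure x)) (pure (basis_word d w)))"
    if x: "x \<in> Poly_Mapping.keys v" for x
  proof -
    have xw: "x \<in> words d UNIV" using x assms by blast
    have "tensor_eq d (pure x) (\<Sum>f\<in>{1..d} \<rightarrow>\<^sub>E C \<times> UNIV. fscale (\<Prod>k\<in>{1..d}. mat_coord (f k) (x k))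
        (pure (\<lambda>k. if k \<in> {1..d} then basis_mat (f k) else x k)))"
    proof (rule tensor_eq_pure_expand[OF _ order_refl _ xw])
      fix k assume k: "k \<in> {1..d}"
      show "x k = (\<Sum>j\<in>C \<times> UNIV. mscale (mat_coord j (x k)) (basis_mat j))"
      proof (rule mat_expand[OF fin CB])
        show "fst i \<in> C" if "mat_coord i (x k) \<noteq> 0" for i
          using x k that unfolding C_def mat_coord_def by blast
      qed
    qed (use fin in auto)
    moreover have "(\<lambda>k. if k \<in> {1..d} then basis_mat (f k) else x k) = basis_word d f" for f
      using xw by (auto simp: basis_word_def words_def PiE_iff extensional_def)
    ultimately show ?thesis by (simp only: word_coord_pure words_def)
  qed
  have "tensor_eq d (\<Sum>x\<in>Poly_Mapping.keys v. fscale (Poly_Mapping.lookup v x) (pure x))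
     (\<Sum>x\<in>Poly_Mapping.keys v. fscale (Poly_Mapping.lookup v x)
      (\<Sum>w\<in>words d (C \<times> UNIV). fscale (word_coord d w (pure x)) (pure (basis_word d w))))"
    by (intro tensor_eq_sum tensor_eq_fscale pure)
  also have "(\<Sum>x\<in>Poly_Mapping.keys v. fscale (Poly_Mapping.lookup v x)
      (\<Sum>w\<in>words d (C \<times> UNIV). fscale (word_coord d w (pure x)) (pure (basis_word d w)))) =
    (\<Sum>w\<in>words d (C \<times> UNIV). fscale (word_coord d w v) (pure (basis_word d w)))"
    unfolding fmod.scale_sum_right fmod.scale_scale
    by (subst sum.swap) (simp only: fmod.scale_sum_left word_coord_pure word_coord_def[of d _ v])
  finally have "tensor_eq d v
      (\<Sum>w\<in>words d (C \<times> UNIV). fscale (word_coord d w v) (pure (basis_word d w)))"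
    unfolding poly_mapping_eq_sum_pure[symmetric] .
  then show ?thesis by (rule that[OF fin CB])
qed

text \<open>The coordinates separate tensors: if they agree, all coefficients in the expansion of
  \<open>u - v\<close> vanish.\<close>

lemma tensor_eq_iff_word_coord:
  fixes u v :: "(nat \<Rightarrow> 'a^'n::finite^'n) \<Rightarrow>\<^sub>0 'k"
  assumes "Poly_Mapping.keys u \<subseteq> words d UNIV" "Poly_Mapping.keys v \<subseteq> words d UNIV"
  shows "tensor_eq d u v \<longleftrightarrow>
    (\<forall>w\<in>words d (B \<times> UNIV). word_coord d w u = word_coord d w v)"
proof
  assume *: "\<forall>w\<in>words d (B \<times> UNIV). word_coord d w u = word_coord d w v"
  have "Poly_Mapping.keys (u - v) \<subseteq> words d UNIV" using assms keys_diff[of u v] by blast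
  then obtain C where C: "C \<subseteq> B" "tensor_eq d (u - v)
      (\<Sum>w\<in>words d (C \<times> UNIV). fscale (word_coord d w (u - v)) (pure (basis_word d w)))"
    by (rule tensor_expand)
  have "words d (C \<times> UNIV) \<subseteq> words d (B \<times> UNIV)"
    unfolding words_def using C(1) by (intro PiE_mono) auto
  then have "(\<Sum>w\<in>words d (C \<times> UNIV). fscale (word_coord d w (u - v)) (pure (basis_word d w))) = 0"
    using * by (intro sum.neutral) (auto simp: word_coord_diff)
  with C(2) show "tensor_eq d u v" by (simp add: tensor_eq_def)
next
  assume "tensor_eq d u v"
  from word_coord_tensor_eq[OF this]
  show "\<forall>w\<in>words d (B \<times> UNIV). word_coord d w u = word_coord d w v" by simp
qed

text \<open>Provides the measure for the induction in \<open>in_T_span_etas\<close>.\<close>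

lemma finite_word_coord_support:
  fixes v :: "(nat \<Rightarrow> 'a^'n::finite^'n) \<Rightarrow>\<^sub>0 'k"
  assumes "Poly_Mapping.keys v \<subseteq> words d UNIV"
  shows "finite {w \<in> words d (B \<times> UNIV). word_coord d w v \<noteq> 0}"
proof -
  obtain C where C: "finite C" "C \<subseteq> B" "tensor_eq d v
      (\<Sum>w\<in>words d (C \<times> UNIV). fscale (word_coord d w v) (pure (basis_word d w)))"
    using assms by (rule tensor_expand)
  have sub: "words d (C \<times> UNIV) \<subseteq> words d (B \<times> UNIV :: ('a \<times> 'n \<times> 'n) set)"
    unfolding words_def using C(2) by (intro PiE_mono) auto
  have "word_coord d w v = 0" if w: "w \<in> words d (B \<times> UNIV)" "w \<notin> words d (C \<times> UNIV)" for w
  proof -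
    have "word_coord d w (pure (basis_word d w')) = 0" if "w' \<in> words d (C \<times> UNIV)" for w'
      using that w sub by (subst word_coord_basis_word) auto
    then show ?thesis
      by (subst word_coord_tensor_eq[OF C(3)])
        (auto simp only: word_coord_sum word_coord_fscale mult_zero_right intro!: sum.neutral)
  qed
  then have "{w \<in> words d (B \<times> UNIV). word_coord d w v \<noteq> 0} \<subseteq> words d (C \<times> UNIV)" by blast
  moreover have "finite (words d (C \<times> UNIV :: ('a \<times> 'n \<times> 'n) set))"
    unfolding words_def using C(1) by (intro finite_PiE) auto
  ultimately show ?thesis by (rule finite_subset)
qed

text \<open>\<open>act\<close> sums over all parity words \<epsilon>. A coordinate at a homogeneous
  basis word sees only the summand whose parities are those of \<open>w\<close>, and there the
  product is merely reindexed by \<sigma>.\<close>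

lemma word_coord_act:
  fixes v :: "(nat \<Rightarrow> 'a^'n::finite^'n) \<Rightarrow>\<^sub>0 'k"
  assumes \<sigma>: "\<sigma> permutes {1..d}"
  shows "word_coord d (w \<circ> \<sigma>) (act d \<sigma> v) = odd_sign d \<sigma> (odd_at w) * word_coord d w v"
proof -
  \<comment> \<open>Restricted to \<open>{1..d}\<close>, since the sum in \<open>act\<close> runs
    over words, which are \<open>undefined\<close> elsewhere.\<close>
  define p where "p = (\<lambda>k\<in>{1..d}. odd_at w k)"
  have p: "p \<in> words d UNIV" and fin: "finite (words d (UNIV :: bool set))"
    by (auto simp: p_def words_def finite_PiE)
  have eq: "(\<Prod>i\<in>{1..d}. mat_coord ((w \<circ> \<sigma>) i) (mpart (\<epsilon> (\<sigma> i)) (x (\<sigma> i)))) =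
      (if \<epsilon> = p then \<Prod>k\<in>{1..d}. mat_coord (w k) (x k) else 0)" if \<epsilon>: "\<epsilon> \<in> words d UNIV" for \<epsilon> x
  proof -
    have "(\<Prod>i\<in>{1..d}. mat_coord ((w \<circ> \<sigma>) i) (mpart (\<epsilon> (\<sigma> i)) (x (\<sigma> i)))) =
        (\<Prod>k\<in>{1..d}. mat_coord (w k) (mpart (\<epsilon> k) (x k)))"
      using prod.permute[OF \<sigma>, of "\<lambda>k. mat_coord (w k) (mpart (\<epsilon> k) (x k))"] by (simp add: o_def)
    also have "\<dots> = (if \<forall>k\<in>{1..d}. \<epsilon> k = odd_at w k then \<Prod>k\<in>{1..d}. mat_coord (w k) (x k) else 0)"
      by (auto simp: mat_coord_mpart odd_at_def intro!: prod.cong)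
    also have "(\<forall>k\<in>{1..d}. \<epsilon> k = odd_at w k) \<longleftrightarrow> \<epsilon> = p"
    proof
      assume "\<forall>k\<in>{1..d}. \<epsilon> k = odd_at w k"
      then show "\<epsilon> = p"
        using PiE_ext[OF \<epsilon>[unfolded words_def] p[unfolded words_def]] by (simp add: p_def)
    qed (simp add: p_def)
    finally show ?thesis .
  qed
  have "word_coord d (w \<circ> \<sigma>) (act d \<sigma> v) = (\<Sum>x\<in>Poly_Mapping.keys v. \<Sum>\<epsilon>\<in>words d UNIV.
      Poly_Mapping.lookup v x * (- 1) ^ inversions d \<sigma> \<epsilon> *
      (\<Prod>i\<in>{1..d}. mat_coord ((w \<circ> \<sigma>) i) (mpart (\<epsilon> (\<sigma> i)) (x (\<sigma> i)))))"
    unfolding act_def word_coord_sum word_coord_fscale word_coord_pure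
    by (intro sum.cong refl arg_cong2[of _ _ _ _ "(*)"] prod.cong) simp
  also have "\<dots> = (\<Sum>x\<in>Poly_Mapping.keys v. \<Sum>\<epsilon>\<in>words d UNIV. if \<epsilon> = p then
      Poly_Mapping.lookup v x * (- 1) ^ inversions d \<sigma> p * (\<Prod>k\<in>{1..d}. mat_coord (w k) (x k)) else 0)"
    by (intro sum.cong refl) (simp only: eq, simp)
  also have "\<dots> = (\<Sum>x\<in>Poly_Mapping.keys v. 
      Poly_Mapping.lookup v x * (- 1) ^ inversions d \<sigma> p * (\<Prod>k\<in>{1..d}. mat_coord (w k) (x k)))"
    using p fin by simp
  also have "inversions d \<sigma> p = inversions d \<sigma> (odd_at w)"
    by (rule inversions_cong) (simp add: p_def)
  finally show ?thesis
    unfolding odd_sign_def word_coord_def by (simp add: sum_distrib_left mult_ac)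
qed

end

section \<open>Orbit sums and their span\<close>

text \<open>Packing the triple into one word makes its stabilizer the stabilizer of a single
  function.\<close>

definition zip_word ::
  "nat \<Rightarrow> (nat \<Rightarrow> 'a) \<Rightarrow> (nat \<Rightarrow> 'n) \<Rightarrow> (nat \<Rightarrow> 'n) \<Rightarrow> nat \<Rightarrow> 'a \<times> 'n \<times> 'n" where
  "zip_word d b r s = (\<lambda>k\<in>{1..d}. (b k, r k, s k))"

lemma zip_word_in_words:
  "b \<in> words d X \<Longrightarrow> zip_word d b r s \<in> words d (X \<times> UNIV)"
  by (auto simp: zip_word_def words_def simp del: atLeastAtMost_iff dest: PiE_mem)

lemma words_eq_zip_word:
  assumes "w \<in> words d (X \<times> UNIV)"
  obtains b r s where "b \<in> words d X" "r \<in> words d UNIV" "s \<in> words d UNIV" "w = zip_word d b r s"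
proof (rule that)
  let ?b = "\<lambda>k\<in>{1..d}. fst (w k)" and ?r = "\<lambda>k\<in>{1..d}. fst (snd (w k))"
    and ?s = "\<lambda>k\<in>{1..d}. snd (snd (w k))"
  show "?b \<in> words d X"
    using assms unfolding words_def by (intro restrict_PiE_iff[THEN iffD2]) (auto dest!: PiE_mem)
  show "?r \<in> words d UNIV" "?s \<in> words d UNIV" by (simp_all add: words_def)
  have "w k = zip_word d ?b ?r ?s k" for k
    using PiE_arb[OF assms[unfolded words_def], of k] by (simp add: zip_word_def)
  then show "w = zip_word d ?b ?r ?s" ..
qed

text \<open>A Young subgroup: the product of the symmetric groups on the sets of positions that
  carry the same letter from \<open>C\<close>.\<close>

definition part_stabilizer :: "nat \<Rightarrow> 'a set \<Rightarrow> (nat \<Rightarrow> 'a \<times> 'n \<times> 'n) \<Rightarrow> (nat \<Rightarrow> nat) set" where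
  "part_stabilizer d C w = {\<sigma>. \<sigma> permutes {k \<in> {1..d}. fst (w k) \<in> C} \<and> w \<circ> \<sigma> = w}"

lemma subgroup_part_stabilizer: "subgroup (part_stabilizer d C w) (sym_group d)"
  unfolding part_stabilizer_def by (rule subgroup_stabilizer) blast

text \<open>The order depends only on the multiplicities of the letters, and these are unchanged
  when the positions are permuted.\<close>

lemma card_part_stabilizer_comp:
  assumes \<sigma>: "\<sigma> permutes {1..d}"
  shows "card (part_stabilizer d C (w \<circ> \<sigma>)) = card (part_stabilizer d C w)"
proof -
  have eq: "card (part_stabilizer d C w) =
      (\<Prod>t\<in>{t \<in> w ` {1..d}. fst t \<in> C}. fact (card {k \<in> {1..d}. w k = t}))" for w :: "nat \<Rightarrow> 'a \<times> 'n \<times> 'n"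
  proof -
    have "card (part_stabilizer d C w) = (\<Prod>t\<in>{t \<in> w ` {1..d}. fst t \<in> C}.
        fact (card {k \<in> {k \<in> {1..d}. fst (w k) \<in> C}. w k = t}))"
      unfolding part_stabilizer_def by (rule card_stabilizer_eq_prod_fact) auto
    also have "\<dots> = (\<Prod>t\<in>{t \<in> w ` {1..d}. fst t \<in> C}. fact (card {k \<in> {1..d}. w k = t}))"
      by (intro prod.cong refl arg_cong[of _ _ fact] arg_cong[of _ _ card]) auto
    finally show ?thesis .
  qed
  have im: "(w \<circ> \<sigma>) ` {1..d} = w ` {1..d}"
    using permutes_image[OF \<sigma>] by (simp only: image_comp[symmetric])
  have "card {k \<in> {1..d}. (w \<circ> \<sigma>) k = t} = card {k \<in> {1..d}. w k = t}" for t
  proof -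
    have "\<sigma> ` {k \<in> {1..d}. (w \<circ> \<sigma>) k = t} = {k \<in> {1..d}. w k = t}"
    proof (intro equalityI subsetI)
      fix k assume k: "k \<in> {k \<in> {1..d}. w k = t}"
      have "inv' \<sigma> k \<in> {1..d}" "\<sigma> (inv' \<sigma> k) = k"
        using k permutes_in_image[OF permutes_inv[OF \<sigma>], of k] permutes_inverses(1)[OF \<sigma>, of k] by auto
      then show "k \<in> \<sigma> ` {k \<in> {1..d}. (w \<circ> \<sigma>) k = t}"
        using k by (intro image_eqI[of _ _ "inv' \<sigma> k"]) auto
    qed (use permutes_in_image[OF \<sigma>] in auto)
    then show ?thesis
      using card_image[OF inj_on_subset[OF permutes_inj[OF \<sigma>] subset_UNIV],
          of "{k \<in> {1..d}. (w \<circ> \<sigma>) k = t}"] by (simp only:)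
  qed
  then show ?thesis unfolding eq im by simp
qed

context superalgebra
begin

lemma basis_word_zip_word:
  "(\<lambda>k\<in>{1..d}. munit (b k) (r k) (s k)) = basis_word d (zip_word d b r s)"
  by (auto simp: basis_word_def basis_mat_def zip_word_def)

lemma stab_eq:
  assumes "b \<in> words d X" "r \<in> words d UNIV" "s \<in> words d UNIV"
  shows "stab d b r s =
    {\<sigma>. \<sigma> permutes {1..d} \<and> zip_word d b r s \<circ> \<sigma> = zip_word d b r s}"
proof -
  have "b \<circ> \<sigma> = b \<and> r \<circ> \<sigma> = r \<and> s \<circ> \<sigma> = s \<longleftrightarrow> zip_word d b r s \<circ> \<sigma> = zip_word d b r s"
    if \<sigma>: "\<sigma> permutes {1..d}" for \<sigma>
  proof -
    have comp: "x \<circ> \<sigma> = x \<longleftrightarrow> (\<forall>k\<in>{1..d}. x (\<sigma> k) = x k)" for x :: "nat \<Rightarrow> 'z"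
    proof
      assume *: "\<forall>k\<in>{1..d}. x (\<sigma> k) = x k"
      have "x (\<sigma> k) = x k" for k
        using * permutes_not_in[OF \<sigma>, of k] by (cases "k \<in> {1..d}") auto
      then show "x \<circ> \<sigma> = x" by auto
    qed (auto dest: fun_cong)
    have "zip_word d b r s (\<sigma> k) = zip_word d b r s k \<longleftrightarrow> b (\<sigma> k) = b k \<and> r (\<sigma> k) = r k \<and> s (\<sigma> k) = s k"
      if "k \<in> {1..d}" for k
      using that permutes_in_image[OF \<sigma>, of k] by (simp add: zip_word_def)
    then show ?thesis unfolding comp by blast
  qed
  then show ?thesis unfolding stab_def sym_group_carrier by blast
qed

text \<open>Turns the factor in \<open>eta\<close> into the order of a group, so that Lagrange's
  theorem can be applied to it.\<close>

lemma cfact_eq_card: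
  fixes r s :: "nat \<Rightarrow> 'n::finite"
  shows "cfact d C b r s = card (part_stabilizer d C (zip_word d b r s))"
proof -
  let ?w = "zip_word d b r s"
  \<comment> \<open>\<open>?T\<close> also contains letters that do not occur in the word; they
    contribute \<open>0! = 1\<close> on both sides.\<close>
  let ?Q = "{k \<in> {1..d}. fst (?w k) \<in> C}" and ?T = "(C \<inter> b ` {1..d}) \<times> (UNIV :: ('n \<times> 'n) set)"
  have "card (part_stabilizer d C ?w) = (\<Prod>t\<in>?T. fact (card {k \<in> ?Q. ?w k = t}))"
    unfolding part_stabilizer_def
    by (rule card_stabilizer_eq_prod_fact) (auto simp: zip_word_def)
  also have "\<dots> = (\<Prod>(c, i, j)\<in>?T. fact (card {k \<in> {1..d}. b k = c \<and> r k = i \<and> s k = j}))"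
    by (intro prod.cong refl)
      (auto simp: zip_word_def intro!: arg_cong[of _ _ fact] arg_cong[of _ _ card])
  also have "\<dots> = cfact d C b r s"
    unfolding cfact_def by (simp add: prod.cartesian_product case_prod_unfold flip: UNIV_Times_UNIV)
  finally show ?thesis ..
qed

lemma keys_act:
  "Poly_Mapping.keys (act d \<sigma> v) \<subseteq> words d UNIV"
proof -
  have "Poly_Mapping.keys (fscale c (pure (\<lambda>i\<in>{1..d}. x i)) :: (nat \<Rightarrow> 'z) \<Rightarrow>\<^sub>0 'k) \<subseteq> words d UNIV" for c x
    by (rule subset_trans[OF keys_fscale]) (auto simp: pure_def words_def)
  then show ?thesis
    unfolding act_def by (intro subset_trans[OF keys_sum] UN_least)
qed

lemma keys_xi: "Poly_Mapping.keys (xi d b r s) \<subseteq> words d UNIV"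
  unfolding xi_def by (intro subset_trans[OF keys_sum] UN_least keys_act)

text \<open>Stated on representatives and without a basis, so that it carries over unchanged from
  one basis to another.\<close>

definition symmetric :: "nat \<Rightarrow> ((nat \<Rightarrow> 'a^'n^'n) \<Rightarrow>\<^sub>0 'k) \<Rightarrow> bool" where
  "symmetric d v \<longleftrightarrow> (\<forall>\<sigma>. \<sigma> permutes {1..d} \<longrightarrow> tensor_eq d (act d \<sigma> v) v)"

end

context parity_basis
begin

text \<open>A basis element that is both even and odd would be 0. This translates the condition in
  \<open>Tri\<close> into the parity used by \<open>odd_at\<close>.\<close>

lemma mem_A0_iff: "b \<in> B \<Longrightarrow> b \<in> A0 \<longleftrightarrow> b \<notin> B1"
proof
  assume b: "b \<in> B" "b \<in> A0"
  show "b \<notin> B1"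
  proof
    assume "b \<in> B1"
    then have "b = 0" using b(2) B1_subset A0_Int_A1 by blast
    then show False
      using representation_basis[OF independent_B b(1)] representation_zero[of B] by (metis zero_neq_one)
  qed
qed (use B0_subset in blast)

text \<open>Every word is of the form \<open>w \<circ> \<sigma>\<close>, so
  \<open>word_coord_act\<close> compares \<open>act d \<sigma> v\<close> with \<open>v\<close> at
  all words.\<close>

lemma symmetric_iff:
  fixes v :: "(nat \<Rightarrow> 'a^'n::finite^'n) \<Rightarrow>\<^sub>0 'k"
  assumes "Poly_Mapping.keys v \<subseteq> words d UNIV"
  shows "symmetric d v \<longleftrightarrow> (\<forall>\<sigma>. \<forall>w\<in>words d (B \<times> UNIV). \<sigma> permutes {1..d} \<longrightarrow>
    word_coord d (w \<circ> \<sigma>) v = odd_sign d \<sigma> (odd_at w) * word_coord d w v)" (is "_ \<longleftrightarrow> ?R")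
proof
  assume v: "symmetric d v"
  show ?R
  proof (intro allI ballI impI)
    fix \<sigma> w assume \<sigma>: "\<sigma> permutes {1..d}"
    then have "word_coord d (w \<circ> \<sigma>) (act d \<sigma> v) = word_coord d (w \<circ> \<sigma>) v"
      using v by (intro word_coord_tensor_eq) (simp add: symmetric_def)
    with word_coord_act[OF \<sigma>, of w v]
    show "word_coord d (w \<circ> \<sigma>) v = odd_sign d \<sigma> (odd_at w) * word_coord d w v" by (simp only:)
  qed
next
  assume v: ?R
  show "symmetric d v"
    unfolding symmetric_def
  proof (intro allI impI)
    fix \<sigma> assume \<sigma>: "\<sigma> permutes {1..d}"
    show "tensor_eq d (act d \<sigma> v) v"
      unfolding tensor_eq_iff_word_coord[OF keys_act assms]
    proof
      fix u :: "nat \<Rightarrow> 'a \<times> 'n \<times> 'n" assume "u \<in> words d (B \<times> UNIV)"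
      then have w: "u \<circ> inv' \<sigma> \<in> words d (B \<times> UNIV)"
        using permutes_inv[OF \<sigma>] by (rule words_comp)
      have u: "u = (u \<circ> inv' \<sigma>) \<circ> \<sigma>"
        using permutes_inv_o(2)[OF \<sigma>] by (simp only: comp_assoc comp_id)
      have "word_coord d (u \<circ> inv' \<sigma> \<circ> \<sigma>) (act d \<sigma> v) = word_coord d (u \<circ> inv' \<sigma> \<circ> \<sigma>) v"
        unfolding word_coord_act[OF \<sigma>] by (rule v[rule_format, OF w \<sigma>, symmetric])
      then show "word_coord d u (act d \<sigma> v) = word_coord d u v" by (simp only: u[symmetric])
    qed
  qed
qed

text \<open>\<open>tact\<close> takes the union over all representatives \<open>u\<close> of the
  class, so \<open>act\<close> has to respect \<open>tensor_eq\<close>. The coordinates show this: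
  those of \<open>act d \<sigma> u\<close> are determined by those of \<open>u\<close>.\<close>

lemma tclass_in_schur_S:
  fixes v :: "(nat \<Rightarrow> 'a^'n::finite^'n) \<Rightarrow>\<^sub>0 'k"
  assumes keys: "Poly_Mapping.keys v \<subseteq> words d UNIV" and sym: "symmetric d v"
  shows "tclass d v \<in> schur_S d"
proof -
  have "tact d \<sigma> (tclass d v) = tclass d v" if \<sigma>: "\<sigma> permutes {1..d}" for \<sigma>
  proof -
    have "tclass d (act d \<sigma> u) = tclass d v" if "u \<in> tclass d v" for u
    proof -
      have u: "tensor_eq d u v" using that by (simp add: tclass_def tensor_eq_def)
      have "tensor_eq d (act d \<sigma> u) (act d \<sigma> v)"
        unfolding tensor_eq_iff_word_coord[OF keys_act keys_act]
      proof
        fix w :: "nat \<Rightarrow> 'a \<times> 'n \<times> 'n"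
        have w: "w = (w \<circ> inv' \<sigma>) \<circ> \<sigma>"
          using permutes_inv_o(2)[OF \<sigma>] by (simp only: comp_assoc comp_id)
        have "word_coord d (w \<circ> inv' \<sigma> \<circ> \<sigma>) (act d \<sigma> u) = word_coord d (w \<circ> inv' \<sigma> \<circ> \<sigma>) (act d \<sigma> v)"
          unfolding word_coord_act[OF \<sigma>] word_coord_tensor_eq[OF u] ..
        then show "word_coord d w (act d \<sigma> u) = word_coord d w (act d \<sigma> v)" by (simp only: w[symmetric])
      qed
      also have "tensor_eq d (act d \<sigma> v) v" using sym \<sigma> by (simp add: symmetric_def)
      finally show ?thesis by (simp only: tclass_eq_iff)
    qed
    moreover have "v \<in> tclass d v" using tensor_eq_refl by (simp add: tclass_def tensor_eq_def)
    ultimately show ?thesis unfolding tact_def by blast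
  qed
  then show ?thesis
    using keys by (auto simp: schur_S_def tensor_power_def sym_group_carrier)
qed

section \<open>Coordinates of the orbit sums\<close>

lemma Tri_words:
  assumes "(b, r, s) \<in> Tri d B"
  shows "b \<in> words d B" "r \<in> words d UNIV" "s \<in> words d UNIV" "zip_word d b r s \<in> words d (B \<times> UNIV)"
  using assms zip_word_in_words by (auto simp: Tri_def)

text \<open>In a triple from \<open>Tri\<close> only even letters repeat, so a permutation fixing
  the word leaves every odd position in place.\<close>

lemma odd_sign_stabilizer:
  assumes T: "(b, r, s) \<in> Tri d B" and \<sigma>: "\<sigma> permutes {1..d}"
    and fixed: "zip_word d b r s \<circ> \<sigma> = zip_word d b r s"
  shows "odd_sign d \<sigma> (odd_at (zip_word d b r s)) = 1"
proof (rule odd_sign_fixed[OF \<sigma>], rule ccontr)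
  fix k assume k: "k \<in> {1..d}" "odd_at (zip_word d b r s) k" "\<sigma> k \<noteq> k"
  have \<sigma>k: "\<sigma> k \<in> {1..d}" using k(1) permutes_in_image[OF \<sigma>] by blast
  have "zip_word d b r s (\<sigma> k) = zip_word d b r s k" using fun_cong[OF fixed, of k] by simp
  then have "(b k, r k, s k) = (b (\<sigma> k), r (\<sigma> k), s (\<sigma> k))"
    using k(1) \<sigma>k by (simp add: zip_word_def)
  moreover have "\<forall>k\<in>{1..d}. \<forall>l\<in>{1..d}. k \<noteq> l \<and> (b k, r k, s k) = (b l, r l, s l) \<longrightarrow> b k \<in> A0"
    using T by (simp add: Tri_def)
  ultimately have "b k \<in> A0" using k(1) k(3)[symmetric] \<sigma>k by blast
  moreover have "b k \<in> B" using Tri_words(1)[OF T] k(1) unfolding words_def by (rule PiE_mem)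
  ultimately show False using k(1,2) mem_A0_iff[of "b k"] by (simp add: odd_at_def zip_word_def)
qed

text \<open>The cosets of the stabilizer correspond to the words in the orbit of \<open>w\<close>,
  so each of these words receives exactly one signed summand of \<open>xi\<close>.\<close>

lemma word_coord_xi:
  fixes r s :: "nat \<Rightarrow> 'n::finite"
  assumes T: "(b, r, s) \<in> Tri d B"
  defines "w \<equiv> zip_word d b r s"
  shows "\<rho> permutes {1..d} \<Longrightarrow> word_coord d (w \<circ> \<rho>) (xi d b r s) = odd_sign d \<rho> (odd_at w)"
    and "u \<in> words d (B \<times> UNIV) \<Longrightarrow> u \<notin> (\<circ>) w ` {\<rho>. \<rho> permutes {1..d}} \<Longrightarrow>
      word_coord d u (xi d b r s) = 0"
proof -
  interpret G: group "sym_group d" by (rule sym_group_is_group)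
  let ?H = "stab d b r s"
  have w: "w \<in> words d (B \<times> UNIV)" unfolding w_def by (rule Tri_words(4)[OF T])
  have H: "?H = {\<sigma>. \<sigma> permutes {1..d} \<and> w \<circ> \<sigma> = w}"
    unfolding w_def by (rule stab_eq[OF Tri_words(1-3)[OF T]])
  have sub: "subgroup ?H (sym_group d)" unfolding H by (rule subgroup_stabilizer) simp
  define rep where "rep C = (SOME \<sigma>. \<sigma> \<in> C)" for C :: "(nat \<Rightarrow> nat) set"
  have rep_mem: "rep C \<in> C" if "C \<in> rcosets\<^bsub>sym_group d\<^esub> ?H" for C
    unfolding rep_def using subgroup.rcosets_non_empty[OF sub that] by (simp add: some_in_eq)
  have rep: "rep C permutes {1..d}" if "C \<in> rcosets\<^bsub>sym_group d\<^esub> ?H" for C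
    using subgroup.rcosets_carrier[OF sub sym_group_is_group that] rep_mem[OF that] sym_group_carrier by blast
  \<comment> \<open>The summand of a coset is, up to sign, the basis word
    \<open>w \<circ> rep C\<close>, which is the only word where it has a nonzero
    coordinate.\<close>
  have coord: "word_coord d u (xi d b r s) =
      (\<Sum>C\<in>rcosets\<^bsub>sym_group d\<^esub> ?H. if u = w \<circ> rep C then odd_sign d (rep C) (odd_at w) else 0)"
    if u: "u \<in> words d (B \<times> UNIV)" for u
    unfolding xi_def word_coord_sum rep_def[symmetric] basis_word_zip_word w_def[symmetric]
  proof (rule sum.cong[OF refl])
    fix C assume "C \<in> rcosets\<^bsub>sym_group d\<^esub> ?H"
    note \<sigma> = rep[OF this]
    have u': "u = (u \<circ> inv' (rep C)) \<circ> rep C"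
      using permutes_inv_o(2)[OF \<sigma>] by (simp only: comp_assoc comp_id)
    have w': "w = (w \<circ> rep C) \<circ> inv' (rep C)"
      using permutes_inv_o(1)[OF \<sigma>] by (simp only: comp_assoc comp_id)
    have iff: "u \<circ> inv' (rep C) = w \<longleftrightarrow> u = w \<circ> rep C" 
    proof
      assume "u \<circ> inv' (rep C) = w"
      then show "u = w \<circ> rep C" using u' by (simp only:)
    next
      assume "u = w \<circ> rep C"
      then show "u \<circ> inv' (rep C) = w" using w' by (simp only:)
    qed
    have "word_coord d (u \<circ> inv' (rep C) \<circ> rep C) (act d (rep C) (pure (basis_word d w))) =
        odd_sign d (rep C) (odd_at (u \<circ> inv' (rep C))) * (if u \<circ> inv' (rep C) = w then 1 else 0)"
      unfolding word_coord_act[OF \<sigma>]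
      by (subst word_coord_basis_word[OF words_comp[OF u permutes_inv[OF \<sigma>]] w]) (rule refl)
    then show "word_coord d u (act d (rep C) (pure (basis_word d w))) =
        (if u = w \<circ> rep C then odd_sign d (rep C) (odd_at w) else 0)"
      unfolding u'[symmetric] iff[symmetric] by (auto split: if_splits)
  qed
  show "word_coord d u (xi d b r s) = 0"
    if "u \<in> words d (B \<times> UNIV)" "u \<notin> (\<circ>) w ` {\<rho>. \<rho> permutes {1..d}}"
    unfolding coord[OF that(1)] using that(2) rep by (intro sum.neutral) auto
  show "word_coord d (w \<circ> \<rho>) (xi d b r s) = odd_sign d \<rho> (odd_at w)" if \<rho>: "\<rho> permutes {1..d}"
  proof -
    let ?C = "?H #>\<^bsub>sym_group d\<^esub> \<rho>"
    have \<rho>': "\<rho> \<in> carrier (sym_group d)" using \<rho> by (simp only: sym_group_carrier)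
    have C: "?C \<in> rcosets\<^bsub>sym_group d\<^esub> ?H"
      using G.rcosetsI[OF subgroup.subset[OF sub] \<rho>'] .
    have mem: "\<tau> \<in> ?C \<longleftrightarrow> (\<exists>h\<in>?H. \<tau> = h \<circ> \<rho>)" for \<tau>
      by (auto simp: r_coset_def sym_group_mult)
    \<comment> \<open>Two permutations yield the same word iff they differ by a left factor from the
      stabilizer, that is, iff they lie in the same right coset.\<close>
    have iff: "w \<circ> \<rho> = w \<circ> rep D \<longleftrightarrow> D = ?C" if D: "D \<in> rcosets\<^bsub>sym_group d\<^esub> ?H" for D
    proof
      assume eq: "w \<circ> \<rho> = w \<circ> rep D"
      let ?h = "rep D \<circ> inv' \<rho>"
      have "w \<circ> ?h = w"
        unfolding o_assoc eq[symmetric] by (simp only: comp_assoc permutes_inv_o(1)[OF \<rho>] comp_id)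
      moreover have "?h permutes {1..d}" by (rule permutes_compose[OF permutes_inv[OF \<rho>] rep[OF D]])
      moreover have "rep D = ?h \<circ> \<rho>" by (simp only: comp_assoc permutes_inv_o(2)[OF \<rho>] comp_id)
      ultimately have "rep D \<in> ?C" unfolding mem unfolding H by blast
      moreover have "rep D \<in> D" by (rule rep_mem[OF D])
      ultimately show "D = ?C"
        using G.rcos_disjoint[OF sub] D C by (auto simp: pairwise_def disjnt_def)
    next
      assume "D = ?C"
      then obtain h where "h \<in> ?H" "rep D = h \<circ> \<rho>" using rep_mem[OF D] mem by blast
      then show "w \<circ> \<rho> = w \<circ> rep D" unfolding H by (simp add: o_assoc)
    qed
    have fin: "finite (rcosets\<^bsub>sym_group d\<^esub> ?H)"
    proof (rule finite_subset)
      show "rcosets\<^bsub>sym_group d\<^esub> ?H \<subseteq> Pow (carrier (sym_group d))"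
        by (rule G.rcosets_subset_PowG[OF sub])
      show "finite (Pow (carrier (sym_group d)))"
        using finite_permutations[of "{1..d}"] by (simp add: sym_group_def)
    qed
    have "word_coord d (w \<circ> \<rho>) (xi d b r s) =
        (\<Sum>D\<in>rcosets\<^bsub>sym_group d\<^esub> ?H. if D = ?C then odd_sign d (rep D) (odd_at w) else 0)"
      unfolding coord[OF words_comp[OF w \<rho>]] by (rule sum.cong[OF refl]) (simp only: iff)
    also have "\<dots> = odd_sign d (rep ?C) (odd_at w)" using C fin by simp
    \<comment> \<open>The sign does not depend on the representative: the factor \<open>h\<close>
      from the stabilizer has sign 1 and preserves the parities of \<open>w\<close>.\<close>
    also have "\<dots> = odd_sign d \<rho> (odd_at w)"
    proof -
      obtain h where h: "h permutes {1..d}" "w \<circ> h = w" "rep ?C = h \<circ> \<rho>"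
        using rep_mem[OF C] mem H by blast
      have "odd_sign d h (odd_at w) = 1"
        using odd_sign_stabilizer[OF T h(1)] h(2) unfolding w_def by blast
      then show ?thesis
        unfolding h(3) odd_sign_comp[OF h(1) \<rho>] odd_at_comp[symmetric] h(2) by simp
    qed
    finally show ?thesis .
  qed
qed

end

section \<open>Characterization of T by symmetry and divisibility of coordinates\<close>

locale triple_basis = parity_basis scale A0 A1 "Ba \<union> Bc" B1
  for scale :: "'k::{idom,ring_char_0} \<Rightarrow> 'a::ring \<Rightarrow> 'a" (infixr \<open>\<cdot>\<close> 75)
    and A0 A1 Ba Bc B1 :: "'a set" +
  assumes Ba_Bc_disjoint: "Ba \<inter> Bc = {}"
begin

abbreviation etas :: "nat \<Rightarrow> ((nat \<Rightarrow> 'a^'n::finite^'n) \<Rightarrow>\<^sub>0 'k) set" where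
  "etas d \<equiv> {eta d Bc b r s |b r s. (b, r, s) \<in> Tri d B}"

definition divisible :: "nat \<Rightarrow> ((nat \<Rightarrow> 'a^'n::finite^'n) \<Rightarrow>\<^sub>0 'k) \<Rightarrow> bool" where
  "divisible d v \<longleftrightarrow>
    (\<forall>w\<in>words d (B \<times> UNIV). of_nat (card (part_stabilizer d Bc w)) dvd word_coord d w v)"

definition in_T :: "nat \<Rightarrow> ((nat \<Rightarrow> 'a^'n::finite^'n) \<Rightarrow>\<^sub>0 'k) \<Rightarrow> bool" where
  "in_T d v \<longleftrightarrow> Poly_Mapping.keys v \<subseteq> words d UNIV \<and> symmetric d v \<and> divisible d v"

lemma subspace_in_T: "fmod.subspace {v :: (nat \<Rightarrow> 'a^'n::finite^'n) \<Rightarrow>\<^sub>0 'k. in_T d v}"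
  unfolding fmod.subspace_def mem_Collect_eq
proof (intro conjI ballI allI)
  show "in_T d (0 :: (nat \<Rightarrow> 'a^'n::finite^'n) \<Rightarrow>\<^sub>0 'k)"
    unfolding in_T_def by (auto simp: symmetric_iff divisible_def)
next
  fix u v :: "(nat \<Rightarrow> 'a^'n::finite^'n) \<Rightarrow>\<^sub>0 'k"
  assume "u \<in> Collect (in_T d)" "v \<in> Collect (in_T d)"
  moreover have "Poly_Mapping.keys (u + v) \<subseteq> words d UNIV" if "in_T d u" "in_T d v"
    using that keys_add[of u v] unfolding in_T_def by blast
  ultimately show "in_T d (u + v)"
    unfolding in_T_def
    by (auto simp: symmetric_iff divisible_def word_coord_add distrib_left
        simp del: o_apply)
next
  fix c and v :: "(nat \<Rightarrow> 'a^'n::finite^'n) \<Rightarrow>\<^sub>0 'k"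
  assume "v \<in> Collect (in_T d)"
  moreover have "Poly_Mapping.keys (fscale c v) \<subseteq> words d UNIV" if "in_T d v"
    using that keys_fscale[of c v] unfolding in_T_def by blast
  ultimately show "in_T d (fscale c v)"
    unfolding in_T_def
    by (auto simp: symmetric_iff divisible_def word_coord_fscale mult.left_commute
        simp del: o_apply)
qed

lemma word_coord_eta:
  "word_coord d u (eta d Bc b r s) =
    of_nat (card (part_stabilizer d Bc (zip_word d b r s))) * word_coord d u (xi d b r s)"
  by (simp only: eta_def word_coord_fscale cfact_eq_card)

lemma keys_eta: "Poly_Mapping.keys (eta d Bc b r s) \<subseteq> words d UNIV"
  unfolding eta_def by (rule subset_trans[OF keys_fscale keys_xi])

text \<open>On the orbit of \<open>w\<close> the coordinates are the signs times the order of the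
  group of \<open>w\<close>, which is constant along the orbit; elsewhere they vanish. Symmetry is
  the composition rule \<open>odd_sign_comp\<close>.\<close>

lemma in_T_eta:
  fixes r s :: "nat \<Rightarrow> 'n::finite"
  assumes T: "(b, r, s) \<in> Tri d B"
  shows "in_T d (eta d Bc b r s)"
proof -
  define w where "w = zip_word d b r s"
  have w: "w \<in> words d (B \<times> UNIV)" unfolding w_def by (rule Tri_words(4)[OF T])
  note xi = word_coord_xi[OF T, folded w_def]
  have eta: "word_coord d u (eta d Bc b r s) =
      of_nat (card (part_stabilizer d Bc w)) * word_coord d u (xi d b r s)" for u
    unfolding w_def by (rule word_coord_eta)
  have "word_coord d (u \<circ> \<sigma>) (xi d b r s) = odd_sign d \<sigma> (odd_at u) * word_coord d u (xi d b r s)"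
    if u: "u \<in> words d (B \<times> UNIV)" and \<sigma>: "\<sigma> permutes {1..d}" for u \<sigma>
  proof (cases "u \<in> (\<circ>) w ` {\<rho>. \<rho> permutes {1..d}}")
    case True
    then obtain \<rho> where \<rho>: "\<rho> permutes {1..d}" "u = w \<circ> \<rho>" by blast
    show ?thesis
      unfolding \<rho>(2) comp_assoc xi(1)[OF \<rho>(1)] xi(1)[OF permutes_compose[OF \<sigma> \<rho>(1)]]
        odd_sign_comp[OF \<rho>(1) \<sigma>] odd_at_comp by (rule mult.commute)
  next
    case False
    have "u \<circ> \<sigma> \<notin> (\<circ>) w ` {\<rho>. \<rho> permutes {1..d}}"
    proof
      assume "u \<circ> \<sigma> \<in> (\<circ>) w ` {\<rho>. \<rho> permutes {1..d}}"
      then obtain \<rho> where \<rho>: "\<rho> permutes {1..d}" "u \<circ> \<sigma> = w \<circ> \<rho>" by blast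
      have "u = (u \<circ> \<sigma>) \<circ> inv' \<sigma>"
        by (simp only: comp_assoc permutes_inv_o(1)[OF \<sigma>] comp_id)
      also have "\<dots> = w \<circ> (\<rho> \<circ> inv' \<sigma>)" unfolding \<rho>(2) comp_assoc ..
      finally show False
        using False permutes_compose[OF permutes_inv[OF \<sigma>] \<rho>(1)] by blast
    qed
    then show ?thesis using xi(2)[OF u False] xi(2)[OF words_comp[OF u \<sigma>]] by simp
  qed
  then have "symmetric d (eta d Bc b r s)"
    unfolding symmetric_iff[OF keys_eta] eta by (simp add: mult.left_commute)
  moreover have "divisible d (eta d Bc b r s)"
    unfolding divisible_def
  proof
    fix u :: "nat \<Rightarrow> 'a \<times> 'n \<times> 'n" assume u: "u \<in> words d (B \<times> UNIV)"
    show "of_nat (card (part_stabilizer d Bc u)) dvd word_coord d u (eta d Bc b r s)"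
    proof (cases "u \<in> (\<circ>) w ` {\<rho>. \<rho> permutes {1..d}}")
      case True
      then obtain \<rho> where \<rho>: "\<rho> permutes {1..d}" "u = w \<circ> \<rho>" by blast
      then have "card (part_stabilizer d Bc u) = card (part_stabilizer d Bc w)"
        by (simp only: card_part_stabilizer_comp)
      then show ?thesis unfolding eta by (simp only: dvd_triv_left)
    next
      case False
      then show ?thesis unfolding eta xi(2)[OF u False] by simp
    qed
  qed
  ultimately show ?thesis unfolding in_T_def using keys_eta by blast
qed

lemma span_etas_in_T: "v \<in> fmod.span (etas d) \<Longrightarrow> in_T d v"
  using fmod.span_minimal[OF _ subspace_in_T, of "etas d" d] in_T_eta by blast

text \<open>If an odd letter stood at two positions, their transposition would fix the word with
  sign -1. The coordinate would equal its own negative, hence be 0 in a domain of characteristic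
  0.\<close>

lemma symmetric_support_Tri:
  fixes v :: "(nat \<Rightarrow> 'a^'n::finite^'n) \<Rightarrow>\<^sub>0 'k"
  assumes keys: "Poly_Mapping.keys v \<subseteq> words d UNIV" and sym: "symmetric d v"
    and b: "b \<in> words d B" and r: "r \<in> words d UNIV" and s: "s \<in> words d UNIV"
    and nz: "word_coord d (zip_word d b r s) v \<noteq> 0"
  shows "(b, r, s) \<in> Tri d B"
proof -
  define w where "w = zip_word d b r s"
  have w: "w \<in> words d (B \<times> UNIV)" unfolding w_def using b by (rule zip_word_in_words)
  have no: "\<not> odd_at w k" if kl: "k \<in> {1..d}" "l \<in> {1..d}" "k < l" "w k = w l" for k l
  proof
    assume odd: "odd_at w k"
    have perm: "transpose k l permutes {1..d}" using kl by (intro permutes_swap_id) auto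
    have "w \<circ> transpose k l = w"
      using kl(4) by (auto simp: transpose_def)
    moreover have "odd_sign d (transpose k l) (odd_at w) = -1"
      using odd kl by (intro odd_sign_transpose) (auto simp: odd_at_def)
    moreover have "word_coord d (w \<circ> transpose k l) v =
        odd_sign d (transpose k l) (odd_at w) * word_coord d w v"
      using sym w perm unfolding symmetric_iff[OF keys] by blast
    ultimately have "word_coord d w v = - word_coord d w v" by (simp only: mult_minus1)
    then have "2 * word_coord d w v = 0" by (simp only: mult_2 add_eq_0_iff)
    with nz show False by (simp add: w_def)
  qed
  have "b k \<in> A0" if kl: "k \<in> {1..d}" "l \<in> {1..d}" "k \<noteq> l" "(b k, r k, s k) = (b l, r l, s l)" for k l
  proof -
    have eq: "w k = w l" using kl by (simp add: w_def zip_word_def)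
    have "\<not> odd_at w k"
    proof (cases "k < l")
      case True
      then show ?thesis using no[of k l] kl eq by blast
    next
      case False
      then have "l < k" using kl(3) by simp
      then have "\<not> odd_at w l" using no[of l k] kl eq by simp
      then show ?thesis by (simp add: odd_at_def eq)
    qed
    moreover have "b k \<in> B" using b kl(1) unfolding words_def by (rule PiE_mem)
    ultimately show ?thesis using kl(1) by (simp add: mem_A0_iff odd_at_def w_def zip_word_def)
  qed
  then show ?thesis using b r s unfolding Tri_def by blast
qed

text \<open>Induction on the number of nonzero coordinates: subtracting a multiple of one
  \<open>eta\<close> clears the whole orbit of a word \<open>w\<close> in the support.\<close>

lemma in_T_span_etas:
  fixes v :: "(nat \<Rightarrow> 'a^'n::finite^'n) \<Rightarrow>\<^sub>0 'k"
  assumes "in_T d v"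
  shows "\<exists>t\<in>fmod.span (etas d). tensor_eq d v t"
  using assms
proof (induction "card {w \<in> words d (B \<times> UNIV). word_coord d w v \<noteq> 0}" arbitrary: v rule: less_induct)
  case less
  let ?S = "\<lambda>v. {w \<in> words d (B \<times> UNIV). word_coord d w v \<noteq> 0}"
  have keys: "Poly_Mapping.keys v \<subseteq> words d UNIV" and sym: "symmetric d v" and div: "divisible d v"
    using less.prems by (auto simp: in_T_def)
  show ?case
  proof (cases "?S v = {}")
    case True
    have "tensor_eq d v 0"
      using True by (subst tensor_eq_iff_word_coord[OF keys]) auto
    then show ?thesis using fmod.span_zero by blast
  next
    case False
    then obtain w where w: "w \<in> words d (B \<times> UNIV)" "word_coord d w v \<noteq> 0" by blast
    obtain b r s where brs: "b \<in> words d B" "r \<in> words d UNIV" "s \<in> words d UNIV" "w = zip_word d b r s"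
      using w(1) by (rule words_eq_zip_word)
    have T: "(b, r, s) \<in> Tri d B"
      using symmetric_support_Tri[OF keys sym brs(1-3)] w(2) brs(4) by blast
    note xi = word_coord_xi[OF T, folded brs(4)]
    let ?c = "of_nat (card (part_stabilizer d Bc w)) :: 'k"
    \<comment> \<open>Divisibility supplies the quotient \<open>q\<close>, with which
      \<open>fscale q\<close> of the \<open>eta\<close> has the same coordinate as \<open>v\<close>
      at \<open>w\<close>.\<close>
    obtain q where q: "word_coord d w v = ?c * q"
      using div w(1) unfolding divisible_def by (blast elim: dvdE)
    define e where "e = fscale q (eta d Bc b r s)"
    have e_span: "e \<in> fmod.span (etas d)"
      unfolding e_def using T by (blast intro: fmod.span_scale fmod.span_base)
    have e: "word_coord d u e = word_coord d w v * word_coord d u (xi d b r s)" for u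
      unfolding e_def word_coord_fscale word_coord_eta brs(4)[symmetric] q by (simp only: mult_ac)
    have "in_T d (v - e)"
      using fmod.subspace_diff[OF subspace_in_T, of v d e] less.prems span_etas_in_T[OF e_span] by blast
    \<comment> \<open>On the orbit of \<open>w\<close>, both \<open>v\<close> and \<open>e\<close>
      have the coordinate of \<open>v\<close> at \<open>w\<close> times the same sign, so they
      cancel; off the orbit \<open>e\<close> has coordinate 0.\<close>
    moreover have "?S (v - e) \<subset> ?S v"
    proof
      show "?S (v - e) \<subseteq> ?S v"
      proof
        fix u assume u: "u \<in> ?S (v - e)"
        show "u \<in> ?S v"
        proof (cases "u \<in> (\<circ>) w ` {\<rho>. \<rho> permutes {1..d}}")
          case True
          then obtain \<rho> where \<rho>: "\<rho> permutes {1..d}" "u = w \<circ> \<rho>" by blast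
          have "word_coord d u v = odd_sign d \<rho> (odd_at w) * word_coord d w v"
            using sym w(1) \<rho> unfolding symmetric_iff[OF keys] by blast
          moreover have "word_coord d u e = odd_sign d \<rho> (odd_at w) * word_coord d w v"
            unfolding e \<rho>(2) xi(1)[OF \<rho>(1)] by (rule mult.commute)
          ultimately show ?thesis using u by (simp add: word_coord_diff)
        next
          case False
          then show ?thesis using u e xi(2)[of u] by (auto simp: word_coord_diff)
        qed
      qed
      have "word_coord d (w \<circ> id) e = word_coord d w v * odd_sign d id (odd_at w)"
        unfolding e xi(1)[OF permutes_id] ..
      then have "word_coord d w (v - e) = 0"
        using odd_sign_fixed[OF permutes_id, of d "odd_at w"] by (simp add: word_coord_diff)
      then show "?S (v - e) \<noteq> ?S v" using w by blast
    qed
    ultimately obtain t where t: "t \<in> fmod.span (etas d)" "tensor_eq d (v - e) t"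
      using less.hyps[OF psubset_card_mono[OF finite_word_coord_support[OF keys]]] by blast
    have "tensor_eq d (v - e + e) (t + e)" by (rule tensor_eq_add[OF t(2) tensor_eq_refl])
    then have "tensor_eq d v (t + e)" by (simp only: diff_add_cancel)
    then show ?thesis using fmod.span_add[OF t(1) e_span] by blast
  qed
qed

lemma schur_T_subset_schur_S:
  "schur_T d Ba Bc B1 \<subseteq> (schur_S d :: ((nat \<Rightarrow> 'a^'n::finite^'n) \<Rightarrow>\<^sub>0 'k) set set)"
  unfolding schur_T_def
proof (rule image_subsetI)
  fix v :: "(nat \<Rightarrow> 'a^'n::finite^'n) \<Rightarrow>\<^sub>0 'k"
  assume "v \<in> fmod.span (etas d)"
  then have "in_T d v" by (rule span_etas_in_T)
  then show "tclass d v \<in> schur_S d" by (simp add: in_T_def tclass_in_schur_S)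
qed

lemma schur_T_eq: "schur_T d Ba Bc B1 = tclass d ` {v :: (nat \<Rightarrow> 'a^'n::finite^'n) \<Rightarrow>\<^sub>0 'k. in_T d v}"
proof
  show "schur_T d Ba Bc B1 \<subseteq> tclass d ` {v :: (nat \<Rightarrow> 'a^'n::finite^'n) \<Rightarrow>\<^sub>0 'k. in_T d v}"
    unfolding schur_T_def using span_etas_in_T by blast
  show "tclass d ` {v :: (nat \<Rightarrow> 'a^'n::finite^'n) \<Rightarrow>\<^sub>0 'k. in_T d v} \<subseteq> schur_T d Ba Bc B1"
  proof
    fix X assume "X \<in> tclass d ` {v :: (nat \<Rightarrow> 'a^'n::finite^'n) \<Rightarrow>\<^sub>0 'k. in_T d v}"
    then obtain v :: "(nat \<Rightarrow> 'a^'n::finite^'n) \<Rightarrow>\<^sub>0 'k" where v: "in_T d v" "X = tclass d v" by blast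
    obtain t where t: "t \<in> fmod.span (etas d)" "tensor_eq d v t"
      using in_T_span_etas[OF v(1)] by blast
    have "X = tclass d t" unfolding v(2) tclass_eq_iff by (rule t(2))
    then show "X \<in> schur_T d Ba Bc B1" using t(1) unfolding schur_T_def by blast
  qed
qed

end

section \<open>Change of basis\<close>

text \<open>The assumption records that \<open>Ba\<close> and \<open>B1\<close> have no components
  along \<open>Bc'\<close>. It relates the bases in one direction only; equality of the submodules
  comes from using the locale twice with the bases exchanged.\<close>

locale two_triple_bases =
  P: triple_basis scale A0 A1 Ba Bc B1 + Q: triple_basis scale A0 A1 Ba' Bc' B1'
  for scale :: "'k::{idom,ring_char_0} \<Rightarrow> 'a::ring \<Rightarrow> 'a" (infixr \<open>\<cdot>\<close> 75)
    and A0 A1 Ba Bc B1 Ba' Bc' B1' :: "'a set" +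
  assumes no_Bc': "b \<in> Ba \<union> B1 \<Longrightarrow> c \<in> Bc' \<Longrightarrow> module.representation scale Q.B b c = 0"
begin

lemma mat_coord_basis_mat_Bc:
  assumes "i \<in> P.B \<times> UNIV" "fst j \<in> Bc'" "Q.mat_coord j (P.basis_mat i) \<noteq> 0"
  shows "fst i \<in> Bc"
proof (rule ccontr)
  assume "fst i \<notin> Bc"
  then have "fst i \<in> Ba \<union> B1" using assms(1) by auto
  from no_Bc'[OF this assms(2)] assms(3) show False
    by (auto simp: Q.mat_coord_def P.basis_mat_def P.munit_def P.representation_zero split: if_splits)
qed

text \<open>The coordinate at \<open>u\<close> is a finite sum over words \<open>w\<close> in the
  old basis, to which \<open>card_dvd_sum_invariant\<close> applies with the group of
  \<open>u\<close>. Terms with \<open>p w = 0\<close> satisfy its conditions trivially.\<close>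

lemma divisible_transfer:
  fixes v :: "(nat \<Rightarrow> 'a^'n::finite^'n) \<Rightarrow>\<^sub>0 'k"
  assumes keys: "Poly_Mapping.keys v \<subseteq> words d UNIV" and sym: "P.symmetric d v" and div: "P.divisible d v"
  shows "Q.divisible d v"
  unfolding Q.divisible_def
proof
  fix u :: "nat \<Rightarrow> 'a \<times> 'n \<times> 'n"
  assume "u \<in> words d (Q.B \<times> UNIV)"
  let ?G = "part_stabilizer d Bc' u" and ?Q = "{k \<in> {1..d}. fst (u k) \<in> Bc'}"
  obtain C where C: "finite C" "C \<subseteq> P.B" "P.tensor_eq d v
      (\<Sum>w\<in>words d (C \<times> UNIV). fscale (P.word_coord d w v) (pure (P.basis_word d w)))"
    using keys by (rule P.tensor_expand)
  define W :: "(nat \<Rightarrow> 'a \<times> 'n \<times> 'n) set" where "W = words d (C \<times> UNIV)"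
  have WP: "W \<subseteq> words d (P.B \<times> UNIV)"
    unfolding W_def words_def using C(2) by (intro PiE_mono) auto
  \<comment> \<open>The entry at \<open>u\<close>, \<open>w\<close> of the change-of-basis matrix on
    the tensor power.\<close>
  define p where "p w = (\<Prod>k\<in>{1..d}. Q.mat_coord (u k) (P.basis_mat (w k)))" for w
  have "Q.word_coord d u v = Q.word_coord d u (\<Sum>w\<in>W. fscale (P.word_coord d w v) (pure (P.basis_word d w)))"
    unfolding W_def by (rule Q.word_coord_tensor_eq[OF C(3)])
  also have "\<dots> = (\<Sum>w\<in>W. P.word_coord d w v * p w)"
    unfolding Q.word_coord_sum Q.word_coord_fscale Q.word_coord_pure p_def
    by (intro sum.cong refl arg_cong2[of _ _ _ _ "(*)"] prod.cong) (simp add: P.basis_word_def)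
  finally have coord: "Q.word_coord d u v = (\<Sum>w\<in>W. P.word_coord d w v * p w)" .
  have G: "\<sigma> permutes ?Q" "u \<circ> \<sigma> = u" "\<sigma> permutes {1..d}" if "\<sigma> \<in> ?G" for \<sigma>
    using that sym_subgroupD(1)[OF subgroup_part_stabilizer that]
    by (simp_all add: part_stabilizer_def)
  \<comment> \<open>A nonzero product has no zero factor, and a letter outside \<open>Bc\<close>
    would give a zero factor at a position where \<open>u\<close> has a letter from
    \<open>Bc'\<close>.\<close>
  have Bc: "fst (w k) \<in> Bc" if "w \<in> W" "p w \<noteq> 0" "k \<in> ?Q" for w k
  proof (rule mat_coord_basis_mat_Bc)
    show "w k \<in> P.B \<times> UNIV" using that(1,3) WP PiE_mem[of w "{1..d}" "\<lambda>_. P.B \<times> UNIV" k] unfolding words_def by blast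
    show "Q.mat_coord (u k) (P.basis_mat (w k)) \<noteq> 0"
      using that(2,3) unfolding p_def by (simp add: prod_zero_iff)
  qed (use that(3) in blast)
  have "of_nat (card ?G) dvd (\<Sum>w\<in>W. P.word_coord d w v * p w)"
  proof (rule card_dvd_sum_invariant[OF subgroup_part_stabilizer])
    show "finite W" unfolding W_def words_def using C(1) by (intro finite_PiE) auto
    show "w \<circ> \<sigma> \<in> W" if "w \<in> W" "\<sigma> \<in> ?G" for w \<sigma>
      using that(1) G(3)[OF that(2)] unfolding W_def by (rule words_comp)
    show "P.word_coord d (w \<circ> \<sigma>) v * p (w \<circ> \<sigma>) = P.word_coord d w v * p w"
      if w: "w \<in> W" and \<sigma>: "\<sigma> \<in> ?G" for w \<sigma>
    proof -
      \<comment> \<open>As \<sigma> fixes \<open>u\<close>, it may be applied to \<open>u\<close> as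
        well; then it only permutes the factors of the product.\<close>
      have "p (w \<circ> \<sigma>) = (\<Prod>k\<in>{1..d}. Q.mat_coord ((u \<circ> \<sigma>) k) (P.basis_mat ((w \<circ> \<sigma>) k)))"
        unfolding p_def G(2)[OF \<sigma>] ..
      also have "\<dots> = p w"
        unfolding p_def using prod.permute[OF G(3)[OF \<sigma>], of "\<lambda>k. Q.mat_coord (u k) (P.basis_mat (w k))"]
        by (simp add: o_def)
      finally have p: "p (w \<circ> \<sigma>) = p w" .
      show ?thesis
      proof (cases "p w = 0")
        case False
        \<comment> \<open>\<sigma> moves only positions in \<open>?Q\<close>, where \<open>w\<close>
          has letters from \<open>Bc\<close>, which are even.\<close>
        have "P.odd_sign d \<sigma> (P.odd_at w) = 1"
        proof (rule P.odd_sign_fixed[OF G(3)[OF \<sigma>]])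
          fix k assume "P.odd_at w k"
          then have "fst (w k) \<notin> Bc" using P.B0_B1_disjoint by (auto simp: P.odd_at_def)
          then have "k \<notin> ?Q" using Bc[OF w False] by blast
          then show "\<sigma> k = k" by (rule permutes_not_in[OF G(1)[OF \<sigma>]])
        qed
        moreover have "P.word_coord d (w \<circ> \<sigma>) v = P.odd_sign d \<sigma> (P.odd_at w) * P.word_coord d w v"
          using sym w WP G(3)[OF \<sigma>] unfolding P.symmetric_iff[OF keys] by blast
        ultimately show ?thesis unfolding p by (simp only: mult_1)
      qed (simp only: p mult_zero_right)
    qed
    show "of_nat (card {\<sigma> \<in> ?G. w \<circ> \<sigma> = w}) dvd P.word_coord d w v * p w" if w: "w \<in> W" for w
    proof (cases "p w = 0")
      case False
      have "subgroup {\<sigma> \<in> ?G. w \<circ> \<sigma> = w} (sym_group d)"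
      proof (rule sym_subgroupI)
        show "id \<in> {\<sigma> \<in> ?G. w \<circ> \<sigma> = w}"
          using sym_subgroupD(2)[OF subgroup_part_stabilizer] by auto
        show "\<sigma> \<circ> \<tau> \<in> {\<sigma> \<in> ?G. w \<circ> \<sigma> = w}"
          if "\<sigma> \<in> {\<sigma> \<in> ?G. w \<circ> \<sigma> = w}" "\<tau> \<in> {\<sigma> \<in> ?G. w \<circ> \<sigma> = w}" for \<sigma> \<tau>
          using that sym_subgroupD(3)[OF subgroup_part_stabilizer, of \<sigma> d Bc' u \<tau>] by (simp add: o_assoc)
        show "inv' \<sigma> \<in> {\<sigma> \<in> ?G. w \<circ> \<sigma> = w}" if "\<sigma> \<in> {\<sigma> \<in> ?G. w \<circ> \<sigma> = w}" for \<sigma>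
          using that sym_subgroupD(4)[OF subgroup_part_stabilizer, of \<sigma> d Bc' u]
            comp_inv_fixed[OF G(3), of \<sigma> w] by simp
      qed (use G(3) in blast)
      moreover have "{\<sigma> \<in> ?G. w \<circ> \<sigma> = w} \<subseteq> part_stabilizer d Bc w"
      proof -
        \<comment> \<open>With this inclusion of positions, an element of \<open>?G\<close> that
          fixes \<open>w\<close> lies in the group of \<open>w\<close> for
          \<open>Bc\<close>.\<close>
        have "?Q \<subseteq> {k \<in> {1..d}. fst (w k) \<in> Bc}" using Bc[OF w False] by blast
        then show ?thesis using G(1) permutes_subset unfolding part_stabilizer_def[of d Bc w] by blast
      qed
      ultimately have "card {\<sigma> \<in> ?G. w \<circ> \<sigma> = w} dvd card (part_stabilizer d Bc w)"
        using subgroup_part_stabilizer by (intro card_sym_subgroup_dvd)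
      then have "of_nat (card {\<sigma> \<in> ?G. w \<circ> \<sigma> = w}) dvd (of_nat (card (part_stabilizer d Bc w)) :: 'k)"
        by (elim dvdE) (simp only: of_nat_mult dvd_triv_left)
      also have "\<dots> dvd P.word_coord d w v" using div w WP unfolding P.divisible_def by blast
      finally show ?thesis by (rule dvd_mult2)
    qed simp
  qed
  then show "of_nat (card ?G) dvd Q.word_coord d u v" unfolding coord .
qed

lemma schur_T_subset:
  "P.schur_T d Ba Bc B1 \<subseteq> (P.schur_T d Ba' Bc' B1' :: ((nat \<Rightarrow> 'a^'n::finite^'n) \<Rightarrow>\<^sub>0 'k) set set)"
  unfolding P.schur_T_eq Q.schur_T_eq
  by (intro image_mono subsetI) (simp add: P.in_T_def Q.in_T_def divisible_transfer)

end

lemma (in good_pair) adapted_basisD: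
  assumes "adapted_basis Ba Bc B1"
  shows "triple_basis scale A0 A1 Ba Bc B1"
    "independent (Ba \<union> Bc \<union> B1)" "span Ba = \<aa>" "span B1 = A1"
    "Bc \<inter> Ba = {}" "Bc \<inter> B1 = {}"
proof -
  obtain \<cc> where c: "complement_in A0 \<aa> \<cc>" "basis_of Bc \<cc>"
    using assms by (auto simp: adapted_basis_def)
  have a: "basis_of Ba \<aa>" and B1: "basis_of B1 A1" and B: "basis_of (Ba \<union> Bc \<union> B1) UNIV"
    and disj: "Ba \<inter> Bc = {}" "Ba \<inter> B1 = {}" "Bc \<inter> B1 = {}"
    using assms by (auto simp: adapted_basis_def)
  have "\<cc> \<subseteq> A0"
  proof
    fix y assume "y \<in> \<cc>"
    moreover have "0 \<in> \<aa>" using subalgebra_a subspace_0 by (auto simp: subalgebra_def)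
    ultimately have "0 + y \<in> {x + y |x y. x \<in> \<aa> \<and> y \<in> \<cc>}" by blast
    moreover have "{x + y |x y. x \<in> \<aa> \<and> y \<in> \<cc>} = A0" using c(1) by (simp add: complement_in_def)
    ultimately show "y \<in> A0" by simp
  qed
  then have "Ba \<union> Bc \<subseteq> A0"
    using a c(2) a_subset span_superset[of Ba] span_superset[of Bc] by (auto simp: basis_of_def)
  moreover have "B1 \<subseteq> A1" using B1 span_superset[of B1] by (auto simp: basis_of_def)
  ultimately show "triple_basis scale A0 A1 Ba Bc B1"
    using B disj by unfold_locales auto
  show "independent (Ba \<union> Bc \<union> B1)" "span Ba = \<aa>" "span B1 = A1" "Bc \<inter> Ba = {}" "Bc \<inter> B1 = {}"
    using B a B1 disj by (auto simp: basis_of_def)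
qed

text \<open>An element of \<open>Ba\<close> lies in \<open>\<aa>\<close>, the span of
  \<open>Ba'\<close>, and one of \<open>B1\<close> lies in \<open>A1\<close>, the span of
  \<open>B1'\<close>. Its expansion therefore uses only \<open>Ba'\<close> or only
  \<open>B1'\<close>, both disjoint from \<open>Bc'\<close>.\<close>

lemma (in good_pair) two_triple_bases:
  assumes "adapted_basis Ba Bc B1" "adapted_basis Ba' Bc' B1'"
  shows "two_triple_bases scale A0 A1 Ba Bc B1 Ba' Bc' B1'"
proof -
  note P = adapted_basisD[OF assms(1)] and Q = adapted_basisD[OF assms(2)]
  have "representation (Ba' \<union> Bc' \<union> B1') b c = 0" if b: "b \<in> Ba \<union> B1" and c: "c \<in> Bc'" for b c
  proof -
    obtain X where X: "X = Ba' \<or> X = B1'" "b \<in> span X"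
      using b P(3,4) Q(3,4) span_base by blast
    then have "representation (Ba' \<union> Bc' \<union> B1') b = representation X b"
      by (intro representation_extend[OF Q(2)]) auto
    moreover have "c \<notin> X" using X(1) c Q(5,6) by blast
    ultimately show ?thesis using representation_ne_zero by metis
  qed
  then show ?thesis
    using P(1) Q(1) by (simp add: two_triple_bases_def two_triple_bases_axioms_def)
qed

theorem proposition4p11:
  fixes scale :: "'k::{idom,ring_char_0} \<Rightarrow> 'a::ring \<Rightarrow> 'a"
    and A0 A1 \<aa> :: "'a set"
    and Ba Bc B1 Ba' Bc' B1' :: "'a set"
    and d :: nat
  assumes "good_pair scale A0 A1 \<aa>"
    and "good_pair.adapted_basis scale A0 A1 \<aa> Ba Bc B1"
    and "good_pair.adapted_basis scale A0 A1 \<aa> Ba' Bc' B1'"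
  shows "superalgebra.schur_T scale A0 A1 d Ba Bc B1 \<subseteq>
      (superalgebra.schur_S scale A0 A1 d :: ((nat \<Rightarrow> 'a^'n::finite^'n) \<Rightarrow>\<^sub>0 'k) set set) \<and>
    superalgebra.schur_T scale A0 A1 d Ba' Bc' B1' \<subseteq>
      (superalgebra.schur_S scale A0 A1 d :: ((nat \<Rightarrow> 'a^'n^'n) \<Rightarrow>\<^sub>0 'k) set set) \<and>
    superalgebra.schur_T scale A0 A1 d Ba Bc B1 =
      (superalgebra.schur_T scale A0 A1 d Ba' Bc' B1'
        :: ((nat \<Rightarrow> 'a^'n^'n) \<Rightarrow>\<^sub>0 'k) set set)"
proof (intro conjI equalityI)
  interpret good_pair scale A0 A1 \<aa> by fact
  show "schur_T d Ba Bc B1 \<subseteq> (schur_S d :: ((nat \<Rightarrow> 'a^'n^'n) \<Rightarrow>\<^sub>0 'k) set set)"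
    by (rule triple_basis.schur_T_subset_schur_S[OF adapted_basisD(1)[OF assms(2)]])
  show "schur_T d Ba' Bc' B1' \<subseteq> (schur_S d :: ((nat \<Rightarrow> 'a^'n^'n) \<Rightarrow>\<^sub>0 'k) set set)"
    by (rule triple_basis.schur_T_subset_schur_S[OF adapted_basisD(1)[OF assms(3)]])
  show "schur_T d Ba Bc B1 \<subseteq> (schur_T d Ba' Bc' B1' :: ((nat \<Rightarrow> 'a^'n^'n) \<Rightarrow>\<^sub>0 'k) set set)"
    by (rule two_triple_bases.schur_T_subset[OF two_triple_bases[OF assms(2,3)]])
  \<comment> \<open>The assumptions are symmetric in the two bases, so the reverse inclusion follows
    by exchanging their roles.\<close>
  show "schur_T d Ba' Bc' B1' \<subseteq> (schur_T d Ba Bc B1 :: ((nat \<Rightarrow> 'a^'n^'n) \<Rightarrow>\<^sub>0 'k) set set)"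
    by (rule two_triple_bases.schur_T_subset[OF two_triple_bases[OF assms(3,2)]])
qed

end
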